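(* Let $C_1,C_2\subseteq\mathbb{F}_q^n$ be linear codes with $C_2\subseteq C_1^{\perp_e}$, and let $Q\subseteq\mathbb{C}^{q^n}$ be the stabilizer code defined by $C_1\times C_2\subseteq\mathbb F_q^{2n}$. Let $\emptyset\neq I\subsetneq J\subseteq\{1,\dots,n\}$. Then $Q$ is $(I,J)$-locally recoverable if and only if both \[\sigma_I\left[\pi_J\left(C_1^{\perp_e}\right)\right]=\sigma_I(C_2)\quad\text{and}\quad\sigma_I\left[\pi_J\left(C_2^{\perp_e}\right)\right]=\sigma_I(C_1)\] hold.
   Context: $q$ is a power of a prime $p$; $C^{\perp_e}$ is the Euclidean dual. For $D\subseteq\mathbb F_q^n$ and $R\subseteq\{1,\dots,n\}$: $\pi_R(D)=\{(c_j)_{j\in R}:\mathbf c\in D\}$, $\sigma_R(D)=\{(c_j)_{j\in R}:\mathbf c\in D,\ \mathrm{supp}(\mathbf c)\subseteq R\}$; the shortening at $I$ of a code with coordinates indexed by $J\supseteq I$ is defined likewise. $C_1\times C_2=\{(\mathbf a|\mathbf b):\mathbf a\in C_1,\mathbf b\in C_2\}$ is self-orthogonal for the symplectic form $(\mathbf a|\mathbf b)\cdot_s(\mathbf c|\mathbf d)=\mathbf a\cdot\mathbf d-\mathbf b\cdot\mathbf c$. With $\xi=e^{2\pi\iota/p}$, $X(a)|x\rangle=|x+a\rangle$, $Z(b)|x\rangle=\xi^{\mathrm{tr}_{q/p}(bx)}|x\rangle$ on $\mathbb C^q$, $E_{(\mathbf a,\mathbf b)}=\bigotimes_jX(a_j)Z(b_j)$,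 the stabilizer code defined by a self-orthogonal $D$ is the common eigenspace $\{v:Ev=\lambda(E)v\ \forall E\in S\}$, $S$ generated by scalars $\xi^\ell\mathcal I$ and $E_{\mathbf y}$, $\mathbf y\in D$, $\lambda$ a character with $\lambda(\xi\mathcal I)=\xi$. Let $\Gamma(\rho)=q^{-2}\sum_{a,b}X(a)Z(b)\rho(X(a)Z(b))^\dagger$ and $\Gamma^I$ apply $\Gamma$ to qudits in $I$, identity elsewhere. $Q$ is $(I,J)$-locally recoverable if there is a trace-preserving quantum operation $\mathcal R$ acting only on the qudits indexed by $J$ with $\mathcal R\circ\Gamma^I(|\varphi\rangle\langle\varphi|)=|\varphi\rangle\langle\varphi|$ for all $|\varphi\rangle\in Q$. *)

theory Defs
  imports Complex_Main
begin

text \<open>The field F_q is a type 'a of class {finite, field}; p = (semiring_char TYPE('a)), q = (card (UNIV :: 'a set)) = p^m.\<close>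

definition fld_ext_deg :: "'a::{finite,field} itself \<Rightarrow> nat" where
  "fld_ext_deg T = (THE m. (card (UNIV :: 'a set)) = (semiring_char TYPE('a)) ^ m)"

definition fld_trace :: "'a::{finite,field} \<Rightarrow> 'a" where
  "fld_trace x = (\<Sum>i<fld_ext_deg TYPE('a). x ^ ((semiring_char TYPE('a)) ^ i))"

definition fld_trace_nat :: "'a::{finite,field} \<Rightarrow> nat" where
  "fld_trace_nat x = (THE k. k < (semiring_char TYPE('a)) \<and> of_nat k = fld_trace x)"

definition xi :: "'a::{finite,field} itself \<Rightarrow> complex" where
  "xi T = exp (2 * complex_of_real pi * \<i> / of_nat (semiring_char TYPE('a)))"

section \<open>Linear codes indexed by a finite coordinate type 'n (coordinates {1..n})\<close>

definition linear_code :: "('n::finite \<Rightarrow> 'a::field) set \<Rightarrow> bool" where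
  "linear_code C \<longleftrightarrow> (\<lambda>_. 0) \<in> C \<and> (\<forall>x\<in>C. \<forall>y\<in>C. (\<lambda>j. x j + y j) \<in> C) \<and> (\<forall>c. \<forall>x\<in>C. (\<lambda>j. c * x j) \<in> C)"

definition edot :: "('n::finite \<Rightarrow> 'a::field) \<Rightarrow> ('n \<Rightarrow> 'a) \<Rightarrow> 'a" where
  "edot x y = (\<Sum>j\<in>UNIV. x j * y j)"

definition edual :: "('n::finite \<Rightarrow> 'a::field) set \<Rightarrow> ('n \<Rightarrow> 'a) set" where
  "edual C = {x. \<forall>c\<in>C. edot x c = 0}"

text \<open>A vector indexed by R is represented by a vector on all coordinates that is 0 outside R.\<close>
definition restr :: "'n set \<Rightarrow> ('n \<Rightarrow> 'a::zero) \<Rightarrow> ('n \<Rightarrow> 'a)" where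
  "restr R x = (\<lambda>j. if j \<in> R then x j else 0)"

definition supp :: "('n \<Rightarrow> 'a::zero) \<Rightarrow> 'n set" where
  "supp x = {j. x j \<noteq> 0}"

definition puncture :: "'n set \<Rightarrow> ('n \<Rightarrow> 'a::zero) set \<Rightarrow> ('n \<Rightarrow> 'a) set" where
  "puncture R D = {restr R c | c. c \<in> D}"

definition shorten :: "'n set \<Rightarrow> ('n \<Rightarrow> 'a::zero) set \<Rightarrow> ('n \<Rightarrow> 'a) set" where
  "shorten R D = {restr R c | c. c \<in> D \<and> supp c \<subseteq> R}"

section \<open>Operators on C^(q^n), with basis |x>, x :: 'n => 'a\<close>

type_synonym ('n, 'a) qop = "('n \<Rightarrow> 'a) \<Rightarrow> ('n \<Rightarrow> 'a) \<Rightarrow> complex"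
type_synonym ('n, 'a) qvec = "('n \<Rightarrow> 'a) \<Rightarrow> complex"

definition op_mult :: "('n::finite, 'a::finite) qop \<Rightarrow> ('n, 'a) qop \<Rightarrow> ('n, 'a) qop" where
  "op_mult A B = (\<lambda>x y. \<Sum>z\<in>UNIV. A x z * B z y)"

definition op_app :: "('n::finite, 'a::finite) qop \<Rightarrow> ('n, 'a) qvec \<Rightarrow> ('n, 'a) qvec" where
  "op_app A v = (\<lambda>x. \<Sum>z\<in>UNIV. A x z * v z)"

definition op_adj :: "('n, 'a) qop \<Rightarrow> ('n, 'a) qop" where
  "op_adj A = (\<lambda>x y. cnj (A y x))"

definition op_id :: "('n, 'a) qop" where
  "op_id = (\<lambda>x y. if x = y then 1 else 0)"

definition op_scal :: "complex \<Rightarrow> ('n, 'a) qop \<Rightarrow> ('n, 'a) qop" where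
  "op_scal c A = (\<lambda>x y. c * A x y)"

text \<open>Single-qudit X(a) Z(b) on C^q: X(a)Z(b)|v> = xi^tr(bv) |v+a>; matrix entry (u,v).\<close>
definition XZ1 :: "'a::{finite,field} \<Rightarrow> 'a \<Rightarrow> 'a \<Rightarrow> 'a \<Rightarrow> complex" where
  "XZ1 a b u v = (if u = v + a then xi TYPE('a) ^ fld_trace_nat (b * v) else 0)"

text \<open>E_(a,b) = tensor_j X(a_j) Z(b_j): entries are products of single-qudit entries.\<close>
definition Eop :: "('n::finite \<Rightarrow> 'a::{finite,field}) \<Rightarrow> ('n \<Rightarrow> 'a) \<Rightarrow> ('n, 'a) qop" where
  "Eop a b = (\<lambda>x y. \<Prod>j\<in>UNIV. XZ1 (a j) (b j) (x j) (y j))"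

inductive_set stab_group :: "(('n::finite \<Rightarrow> 'a::{finite,field}) \<times> ('n \<Rightarrow> 'a)) set \<Rightarrow> ('n, 'a) qop set"
  for D where
  scal: "op_scal (xi TYPE('a) ^ l) op_id \<in> stab_group D"
| gen: "(a, b) \<in> D \<Longrightarrow> Eop a b \<in> stab_group D"
| mult: "A \<in> stab_group D \<Longrightarrow> B \<in> stab_group D \<Longrightarrow> op_mult A B \<in> stab_group D"

definition stab_char :: "(('n::finite \<Rightarrow> 'a::{finite,field}) \<times> ('n \<Rightarrow> 'a)) set \<Rightarrow> (('n, 'a) qop \<Rightarrow> complex) \<Rightarrow> bool" where
  "stab_char D lam \<longleftrightarrow>
     (\<forall>A\<in>stab_group D. \<forall>B\<in>stab_group D. lam (op_mult A B) = lam A * lam B)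
     \<and> lam (op_scal (xi TYPE('a)) op_id) = xi TYPE('a)"

definition stab_code :: "(('n::finite \<Rightarrow> 'a::{finite,field}) \<times> ('n \<Rightarrow> 'a)) set \<Rightarrow> (('n, 'a) qop \<Rightarrow> complex) \<Rightarrow> ('n, 'a) qvec set" where
  "stab_code D lam = {v. \<forall>E\<in>stab_group D. op_app E v = (\<lambda>x. lam E * v x)}"

definition prod_code :: "('n \<Rightarrow> 'a) set \<Rightarrow> ('n \<Rightarrow> 'a) set \<Rightarrow> (('n \<Rightarrow> 'a) \<times> ('n \<Rightarrow> 'a)) set" where
  "prod_code C1 C2 = C1 \<times> C2"

definition ketbra :: "('n, 'a) qvec \<Rightarrow> ('n, 'a) qop" where
  "ketbra v = (\<lambda>x y. v x * cnj (v y))"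

text \<open>Gamma^I = tensor of Gamma on qudits of I, identity elsewhere; expanded:
  q^(-2|I|) sum over a,b supported in I of E_(a,b) rho E_(a,b)^dagger.\<close>
definition Gamma_I :: "'n set \<Rightarrow> ('n::finite, 'a::{finite,field}) qop \<Rightarrow> ('n, 'a) qop" where
  "Gamma_I I rho = (\<lambda>x y.
     (1 / of_nat (card (UNIV :: 'a set)) ^ 2) ^ card I *
     (\<Sum>(a, b)\<in>{(a, b). supp a \<subseteq> I \<and> supp b \<subseteq> I}.
        op_mult (op_mult (Eop a b) rho) (op_adj (Eop a b)) x y))"

text \<open>Operator acting only on the qudits in J: id on the complement tensored with B,
  where B acts on the J-subsystem (vectors restricted to J).\<close>
definition local_op :: "'n set \<Rightarrow> ('n, 'a::zero) qop \<Rightarrow> ('n, 'a) qop" where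
  "local_op J B = (\<lambda>x y. if (\<forall>i. i \<notin> J \<longrightarrow> x i = y i) then B (restr J x) (restr J y) else 0)"

text \<open>Trace-preserving quantum operation acting only on J, in operator-sum (Kraus) form:
  R(rho) = sum_k A_k rho A_k^dagger with sum_k A_k^dagger A_k = I, each A_k = id (x) B_k.\<close>
definition TP_op_on :: "'n set \<Rightarrow> (('n::finite, 'a::{finite,zero}) qop \<Rightarrow> ('n, 'a) qop) \<Rightarrow> bool" where
  "TP_op_on J R \<longleftrightarrow> (\<exists>(m::nat) (B :: nat \<Rightarrow> ('n, 'a) qop).
      (\<lambda>x y. \<Sum>k<m. op_mult (op_adj (local_op J (B k))) (local_op J (B k)) x y) = op_id
    \<and> (\<forall>rho. R rho = (\<lambda>x y. \<Sum>k<m. op_mult (op_mult (local_op J (B k)) rho)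
                                           (op_adj (local_op J (B k))) x y)))"

definition locally_recoverable :: "('n::finite, 'a::{finite,field}) qvec set \<Rightarrow> 'n set \<Rightarrow> 'n set \<Rightarrow> bool" where
  "locally_recoverable Q I J \<longleftrightarrow>
     (\<exists>R. TP_op_on J R \<and> (\<forall>\<phi>\<in>Q. R (Gamma_I I (ketbra \<phi>)) = ketbra \<phi>))"

end

(*
  Necessity. Exact recovery of the pure code states from errors on I by an operation on the
  qudits of J forces every error on I, followed by any Kraus operator of the recovery, to act
  on the code as a scalar. A logical operator E_(u,w) (u in C2^perp, w in C1^perp) whose
  restriction to J is supported on I factors as E_K E_I with E_K supported outside J; E_K
  commutes with the Kraus operators, hence E_I acts on the code as a scalar. For E_I = Z(z|J),
  z in C1^perp, comparing a code state at x0 and x0 + d, d in C2^perp, gives z|J in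
  C2^perp^perp = C2; for E_I = X(z|J), z in C2^perp, a coset state x0 + C1 must be mapped to a
  multiple of itself, so z|J in C1. These are the two shortening identities.

  Sufficiency. Measure the syndrome of the stabilizers supported on J, i.e. project onto the
  characters of (C1 cap V_J) x (C2 cap V_J) with V_J the vectors supported on J, and undo a
  fixed error of the observed syndrome. Two errors on I with equal syndromes differ by vectors
  of (C1 cap V_J)^perp cap V_J = pi_J(C1^perp) and (C2 cap V_J)^perp cap V_J = pi_J(C2^perp)
  supported on I, which the shortening identities place in C2 and C1: the correction is exact
  up to a phase.
*)
theory Submission
  imports Defs "HOL-Number_Theory.Cong" "HOL-Computational_Algebra.Polynomial"
    "HOL-Library.Function_Algebras" "HOL-Library.FuncSet" "HOL-Library.Product_Plus"
    "HOL-Library.Real_Mod"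
begin

section \<open>The canonical additive character of a finite field\<close>

lemma CHAR_pos: "CHAR('a::{finite,field}) > 0"
  by (rule finite_imp_CHAR_pos) simp

lemma prime_CHAR: "prime CHAR('a::{finite,field})"
  using prime_CHAR_semidom[OF CHAR_pos] by simp

lemma CHAR_ge_2: "CHAR('a::{finite,field}) \<ge> 2"
  using prime_CHAR[where 'a='a] prime_ge_2_nat by blast

lemma of_nat_eq_iff_mod_CHAR:
  "(of_nat x :: 'a::{finite,field}) = of_nat y \<longleftrightarrow> x mod CHAR('a) = y mod CHAR('a)"
  by (simp add: of_nat_eq_iff_cong_CHAR cong_def)

lemma of_nat_mod_CHAR: "(of_nat (x mod CHAR('a)) :: 'a::{finite,field}) = of_nat x"
  by (simp add: of_nat_eq_iff_mod_CHAR)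

lemma of_nat_CHAR_minus_1: "(of_nat (CHAR('a) - 1) :: 'a::{finite,field}) = -1"
proof -
  have "(of_nat (CHAR('a) - 1) :: 'a) + 1 = of_nat (CHAR('a) - 1 + 1)" by simp
  also have "CHAR('a) - 1 + 1 = CHAR('a)" using CHAR_pos[where 'a='a] by simp
  finally show ?thesis by (simp add: eq_neg_iff_add_eq_0)
qed

lemma power_card_UNIV:
  fixes x :: "'a :: {finite,field}"
  shows "x ^ card (UNIV :: 'a set) = x"
proof (cases "x = 0")
  case False
  have "x * (\<Prod>y\<in>UNIV-{0}. x * y) = x * x ^ (card (UNIV :: 'a set) - 1) * \<Prod>(UNIV-{0})"
    by (simp add: prod.distrib mult_ac)
  also have "x * x ^ (card (UNIV :: 'a set) - 1) = x ^ Suc (card (UNIV :: 'a set) - 1)"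
    by (subst power_Suc) auto
  also have "Suc (card (UNIV :: 'a set) - 1) = card (UNIV :: 'a set)"
    using finite_UNIV_card_ge_0[where ?'a = 'a] by simp
  also have "(\<Prod>y\<in>UNIV-{0}. x * y) = (\<Prod>y\<in>UNIV-{0}. y)"
    by (rule prod.reindex_bij_witness[of _ "\<lambda>y. y / x" "\<lambda>y. x * y"]) (use False in auto)
  finally show ?thesis
    by simp
qed (use finite_UNIV_card_ge_0[where ?'a = 'a] in auto)

definition prime_subfield :: "'a::{finite,field} set" where
  "prime_subfield = of_nat ` {..<CHAR('a)}"

lemma inj_on_of_nat_CHAR: "inj_on (of_nat :: nat \<Rightarrow> 'a::{finite,field}) {..<CHAR('a)}"
  by (auto simp: inj_on_def of_nat_eq_iff_mod_CHAR)

lemma card_prime_subfield: "card (prime_subfield :: 'a::{finite,field} set) = CHAR('a)"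
  unfolding prime_subfield_def using card_image[OF inj_on_of_nat_CHAR] by simp

lemma of_nat_in_prime_subfield: "(of_nat k :: 'a::{finite,field}) \<in> prime_subfield"
proof -
  have "(of_nat k :: 'a) = of_nat (k mod CHAR('a))" by (simp add: of_nat_mod_CHAR)
  moreover have "k mod CHAR('a) < CHAR('a)" using CHAR_pos[where 'a='a] by simp
  ultimately show ?thesis unfolding prime_subfield_def by blast
qed

lemma of_nat_power_CHAR: "(of_nat k :: 'a::{finite,field}) ^ CHAR('a) = of_nat k"
proof (induction k)
  case 0 then show ?case using CHAR_pos[where 'a='a] by simp
next
  case (Suc k)
  have "(of_nat k + 1 :: 'a) ^ CHAR('a) = of_nat k ^ CHAR('a) + 1 ^ CHAR('a)"
    by (rule freshmans_dream) (auto simp: prime_CHAR)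
  then show ?case using Suc by (simp add: add.commute)
qed

text \<open>The prime subfield has \<open>p\<close> elements, all roots of \<open>X\<^sup>p - X\<close>, which has at most \<open>p\<close> roots.\<close>
lemma power_CHAR_eq_self_iff: "(y :: 'a::{finite,field}) ^ CHAR('a) = y \<longleftrightarrow> y \<in> prime_subfield"
proof -
  let ?p = "CHAR('a)"
  define P :: "'a poly" where "P = monom 1 ?p + [:0,-1:]"
  have degP: "degree P = ?p"
    unfolding P_def using CHAR_ge_2[where 'a='a] by (subst degree_add_eq_left) (auto simp: degree_monom_eq)
  have "P \<noteq> 0" using degP CHAR_ge_2[where 'a='a] by auto
  then have card_roots: "card {x. poly P x = 0} \<le> ?p" using card_poly_roots_bound degP by metis
  have roots: "{x. poly P x = 0} = {y. y ^ ?p = y}"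
    by (auto simp: P_def poly_monom)
  have sub: "(prime_subfield :: 'a set) \<subseteq> {y. y ^ ?p = y}"
    unfolding prime_subfield_def using of_nat_power_CHAR[where 'a='a] by auto
  have "prime_subfield = {y::'a. y ^ ?p = y}"
    by (rule card_subset_eq)
      (use sub card_roots roots card_prime_subfield[where 'a='a] card_mono[OF _ sub] in auto)
  then show ?thesis by blast
qed

lemma prime_subfield_diff:
  "c \<in> prime_subfield \<Longrightarrow> d \<in> prime_subfield \<Longrightarrow> c - d \<in> (prime_subfield :: 'a::{finite,field} set)"
proof -
  assume "c \<in> prime_subfield" "d \<in> prime_subfield"
  then obtain i j where "c = of_nat i" "d = of_nat j" unfolding prime_subfield_def by auto
  then have "c - d = of_nat i + of_nat (CHAR('a) - 1) * of_nat j"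
    by (simp only: of_nat_CHAR_minus_1) simp
  then have "c - d = of_nat (i + (CHAR('a) - 1) * j)" by simp
  then show ?thesis using of_nat_in_prime_subfield by metis
qed


lemma prime_subfield_inverse:
  "c \<in> prime_subfield \<Longrightarrow> inverse c \<in> (prime_subfield :: 'a::{finite,field} set)"
  using power_CHAR_eq_self_iff by (metis power_inverse)

definition add_closed :: "'a::{finite,field} set \<Rightarrow> bool" where
  "add_closed H \<longleftrightarrow> 0 \<in> H \<and> (\<forall>x\<in>H. \<forall>y\<in>H. x + y \<in> H)"

lemma add_closed_of_nat_mult: "add_closed H \<Longrightarrow> x \<in> H \<Longrightarrow> of_nat k * x \<in> H"
  by (induction k) (auto simp: add_closed_def distrib_right)

lemma add_closed_diff:
  assumes "add_closed H" "x \<in> H" "y \<in> (H :: 'a::{finite,field} set)"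
  shows "x - y \<in> H"
proof -
  have "of_nat (CHAR('a) - 1) * y \<in> H" using add_closed_of_nat_mult assms by blast
  then have "- y \<in> H" by (simp only: of_nat_CHAR_minus_1) simp
  then show ?thesis using assms by (metis add_closed_def diff_conv_add_uminus)
qed

lemma add_closed_prime_subfield_mult:
  "add_closed H \<Longrightarrow> x \<in> H \<Longrightarrow> c \<in> prime_subfield \<Longrightarrow> c * x \<in> H"
  unfolding prime_subfield_def using add_closed_of_nat_mult by blast

text \<open>An additively closed set \<open>H\<close> of a finite field is a vector space over the prime field;
  adjoining an element \<open>h \<notin> H\<close> gives \<open>H + \<bbbF>\<^sub>p h\<close>, which is \<open>p\<close> times larger.\<close>
definition adjoin :: "'a::{finite,field} set \<Rightarrow> 'a \<Rightarrow> 'a set" where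
  "adjoin H h = (\<lambda>(x, i). x + of_nat i * h) ` (H \<times> {..<CHAR('a)})"

lemma add_closed_adjoin:
  fixes H :: "'a::{finite,field} set"
  assumes H: "add_closed H"
  shows "add_closed (adjoin H h)"
  unfolding add_closed_def
proof safe
  show "0 \<in> adjoin H h"
    using H CHAR_pos[where 'a='a] unfolding adjoin_def add_closed_def by force
next
  fix u v assume "u \<in> adjoin H h" "v \<in> adjoin H h"
  then obtain x i y j where u: "u = x + of_nat i * h" "x \<in> H"
    and v: "v = y + of_nat j * h" "y \<in> H" unfolding adjoin_def by auto
  have "u + v = (x + y) + of_nat ((i + j) mod CHAR('a)) * h"
    using u v by (simp add: of_nat_mod_CHAR algebra_simps)
  moreover have "x + y \<in> H" using u v H by (auto simp: add_closed_def)
  moreover have "(i + j) mod CHAR('a) < CHAR('a)" using CHAR_pos[where 'a='a] by simp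
  ultimately show "u + v \<in> adjoin H h" unfolding adjoin_def by force
qed

lemma psubset_adjoin:
  fixes H :: "'a::{finite,field} set"
  assumes H: "add_closed H" and h: "h \<notin> H"
  shows "H \<subset> adjoin H h"
proof -
  have "H \<subseteq> adjoin H h"
    unfolding adjoin_def using CHAR_pos[where 'a='a] by (force intro: image_eqI[of _ _ "(x, 0)" for x])
  moreover have "h \<in> adjoin H h"
    unfolding adjoin_def using CHAR_ge_2[where 'a='a] H
    by (force simp: add_closed_def intro: image_eqI[of _ _ "(0, 1)"])
  ultimately show ?thesis using h by blast
qed

lemma card_adjoin:
  fixes H :: "'a::{finite,field} set"
  assumes H: "add_closed H" and h: "h \<notin> H"
  shows "card (adjoin H h) = card H * CHAR('a)"
proof -
  have "inj_on (\<lambda>(x, i). x + of_nat i * h) (H \<times> {..<CHAR('a)})"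
  proof (rule inj_onI, clarify)
    fix x i y j assume xy: "x \<in> H" "i < CHAR('a)" "y \<in> H" "j < CHAR('a)"
      and eq: "x + of_nat i * h = y + (of_nat j :: 'a) * h"
    show "x = y \<and> i = j"
    proof (cases "i = j")
      case True then show ?thesis using eq by simp
    next
      case False
      let ?c = "(of_nat i - of_nat j :: 'a)"
      have c0: "?c \<noteq> 0" using False xy by (simp add: of_nat_eq_iff_mod_CHAR)
      have "?c \<in> prime_subfield" using prime_subfield_diff of_nat_in_prime_subfield by blast
      moreover have "h = inverse ?c * (y - x)" using eq c0 by (simp add: field_simps)
      ultimately have "h \<in> H"
        using add_closed_prime_subfield_mult[OF H add_closed_diff[OF H] prime_subfield_inverse] xy
        by simp
      with h show ?thesis by simp
    qed
  qed
  then show ?thesis unfolding adjoin_def by (subst card_image) (simp_all add: card_cartesian_product)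
qed

lemma card_UNIV_eq_card_add_closed_mult:
  fixes H :: "'a::{finite,field} set"
  assumes "add_closed H"
  shows "\<exists>m. card (UNIV :: 'a set) = card H * CHAR('a) ^ m"
  using assms
proof (induction "card (UNIV - H)" arbitrary: H rule: less_induct)
  case less
  show ?case
  proof (cases "H = UNIV")
    case True then show ?thesis by (intro exI[of _ 0]) simp
  next
    case False
    then obtain h where h: "h \<notin> H" by auto
    have "card (UNIV - adjoin H h) < card (UNIV - H)"
      using psubset_adjoin[OF less.prems h] by (intro psubset_card_mono) auto
    from less.hyps[OF this add_closed_adjoin[OF less.prems]] obtain m
      where "card (UNIV :: 'a set) = card H * CHAR('a) * CHAR('a) ^ m"
      using card_adjoin[OF less.prems h] by auto
    then show ?thesis by (intro exI[of _ "Suc m"]) (simp add: mult_ac)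
  qed
qed

lemma card_UNIV_eq_CHAR_power: "card (UNIV :: 'a::{finite,field} set) = CHAR('a) ^ fld_ext_deg TYPE('a)"
proof -
  have "add_closed {0::'a}" by (simp add: add_closed_def)
  then obtain m where m: "card (UNIV :: 'a set) = CHAR('a) ^ m"
    using card_UNIV_eq_card_add_closed_mult by fastforce
  have "fld_ext_deg TYPE('a) = m"
    unfolding fld_ext_deg_def
    by (rule the_equality) (use m CHAR_ge_2[where 'a='a] in \<open>auto simp: power_inject_exp\<close>)
  with m show ?thesis by simp
qed

lemma fld_ext_deg_pos: "fld_ext_deg TYPE('a::{finite,field}) > 0"
proof (rule ccontr)
  assume "\<not> ?thesis"
  then have "card (UNIV :: 'a set) = 1" using card_UNIV_eq_CHAR_power[where 'a='a] by simp
  moreover have "card {0::'a, 1} \<le> card (UNIV :: 'a set)" by (rule card_mono) auto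
  ultimately show False by simp
qed

lemma fld_trace_add: "fld_trace (x + y :: 'a::{finite,field}) = fld_trace x + fld_trace y"
  unfolding fld_trace_def by (simp add: freshmans_dream'[OF prime_CHAR] sum.distrib)

lemma fld_trace_power_CHAR: "fld_trace (x :: 'a::{finite,field}) ^ CHAR('a) = fld_trace x"
proof -
  let ?m = "fld_ext_deg TYPE('a)" and ?p = "CHAR('a)"
  define f where "f i = x ^ (?p ^ i)" for i
  have "fld_trace x ^ ?p = (\<Sum>i<?m. f i ^ ?p)"
    unfolding fld_trace_def f_def by (rule freshmans_dream_sum[OF prime_CHAR]) simp
  also have "\<dots> = (\<Sum>i<?m. f (Suc i))" by (simp add: f_def power_mult[symmetric] mult.commute)
  also have "\<dots> = (\<Sum>i<?m. f i)"
  proof -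
    have "f ?m = f 0" unfolding f_def using power_card_UNIV[of x] card_UNIV_eq_CHAR_power[where 'a='a] by simp
    then show ?thesis using sum.lessThan_Suc_shift[of f ?m] sum.lessThan_Suc[of f ?m] by simp
  qed
  finally show ?thesis unfolding fld_trace_def f_def .
qed

lemma fld_trace_nat:
  fixes x :: "'a::{finite,field}"
  shows fld_trace_nat_less: "fld_trace_nat x < CHAR('a)"
    and of_nat_fld_trace_nat: "of_nat (fld_trace_nat x) = fld_trace x"
proof -
  obtain k where k: "k < CHAR('a)" "of_nat k = fld_trace x"
    using fld_trace_power_CHAR[of x] unfolding power_CHAR_eq_self_iff prime_subfield_def by auto
  have "fld_trace_nat x < CHAR('a) \<and> of_nat (fld_trace_nat x) = fld_trace x"
    unfolding fld_trace_nat_def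
  proof (rule theI[of _ k])
    show "\<And>k'. k' < CHAR('a) \<and> (of_nat k' :: 'a) = fld_trace x \<Longrightarrow> k' = k"
      using k inj_on_of_nat_CHAR[where 'a='a] by (auto simp: inj_on_def)
  qed (use k in auto)
  then show "fld_trace_nat x < CHAR('a)" "of_nat (fld_trace_nat x) = fld_trace x" by auto
qed

lemma fld_trace_nat_eqI:
  "k < CHAR('a) \<Longrightarrow> (of_nat k :: 'a::{finite,field}) = fld_trace x \<Longrightarrow> fld_trace_nat x = k"
  using fld_trace_nat[of x] inj_on_of_nat_CHAR[where 'a='a] by (auto simp: inj_on_def)

lemma fld_trace_nat_add:
  "fld_trace_nat (x + y :: 'a::{finite,field}) = (fld_trace_nat x + fld_trace_nat y) mod CHAR('a)"
  by (rule fld_trace_nat_eqI) (simp_all add: CHAR_pos of_nat_mod_CHAR of_nat_fld_trace_nat fld_trace_add)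

lemma fld_trace_nat_0: "fld_trace_nat (0 :: 'a::{finite,field}) = 0"
proof (rule fld_trace_nat_eqI)
  show "(of_nat 0 :: 'a) = fld_trace 0"
    unfolding fld_trace_def using CHAR_pos[where 'a='a] by (simp add: power_0_left)
qed (simp add: CHAR_pos)

lemma degree_trace_poly:
  assumes "n > 0"
  shows "degree (\<Sum>i<n. monom (1::'a::{finite,field}) (CHAR('a) ^ i)) = CHAR('a) ^ (n - 1)"
  using assms
proof (induction n)
  case (Suc n)
  show ?case
  proof (cases "n = 0")
    case False
    have "CHAR('a) ^ (n - 1) < CHAR('a) ^ n"
      using CHAR_ge_2[where 'a='a] False by (intro power_strict_increasing) auto
    then show ?thesis using Suc False by (simp add: degree_add_eq_right degree_monom_eq)
  qed (simp add: degree_monom_eq)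
qed simp

text \<open>The trace is a polynomial function of degree \<open>p\<^sup>m\<^sup>-\<^sup>1 < q\<close>, so it cannot vanish everywhere.\<close>
lemma ex_fld_trace_nonzero: "\<exists>x::'a::{finite,field}. fld_trace x \<noteq> 0"
proof (rule ccontr)
  assume "\<not> ?thesis"
  then have all0: "\<forall>x::'a. fld_trace x = 0" by blast
  let ?m = "fld_ext_deg TYPE('a)" and ?p = "CHAR('a)"
  define T :: "'a poly" where "T = (\<Sum>i<?m. monom 1 (?p ^ i))"
  have dT: "degree T = ?p ^ (?m - 1)" unfolding T_def by (rule degree_trace_poly[OF fld_ext_deg_pos])
  have "poly T x = fld_trace x" for x unfolding T_def fld_trace_def by (simp add: poly_sum poly_monom)
  then have "{x. poly T x = 0} = UNIV" using all0 by auto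
  moreover have "T \<noteq> 0" using dT CHAR_pos[where 'a='a] by (metis degree_0 zero_less_power less_irrefl)
  then have "card {x. poly T x = 0} \<le> ?p ^ (?m - 1)" using card_poly_roots_bound dT by metis
  moreover have "?p ^ (?m - 1) < ?p ^ ?m"
    using CHAR_ge_2[where 'a='a] fld_ext_deg_pos[where 'a='a] by (intro power_strict_increasing) auto
  ultimately show False using card_UNIV_eq_CHAR_power[where 'a='a] by simp
qed

lemma xi_power: "xi TYPE('a::{finite,field}) ^ k = cis (2 * pi * k / CHAR('a))"
  unfolding xi_def cis_conv_exp by (simp add: exp_of_nat_mult[symmetric] field_simps)

lemma xi_power_eq_1_iff: "xi TYPE('a::{finite,field}) ^ k = 1 \<longleftrightarrow> CHAR('a) dvd k"
proof -
  have p0: "real CHAR('a) > 0" using CHAR_pos[where 'a='a] by simp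
  have "xi TYPE('a) ^ k = 1 \<longleftrightarrow> (\<exists>n::int. 2 * pi * k / CHAR('a) = of_int n * (2 * pi))"
    unfolding xi_power cis_eq_1_iff ..
  also have "\<dots> \<longleftrightarrow> (\<exists>n::int. real k = of_int n * CHAR('a))"
    using p0 by (auto simp: field_simps)
  also have "\<dots> \<longleftrightarrow> (\<exists>n::int. int k = n * int CHAR('a))"
    by (metis (mono_tags, opaque_lifting) of_int_eq_iff of_int_mult of_int_of_nat_eq of_nat_mult)
  also have "\<dots> \<longleftrightarrow> int CHAR('a) dvd int k" by (auto simp: dvd_def mult.commute)
  finally show ?thesis by simp
qed

lemma xi_power_mod_CHAR: "xi TYPE('a::{finite,field}) ^ (k mod CHAR('a)) = xi TYPE('a) ^ k"
proof -
  have "xi TYPE('a) ^ k = xi TYPE('a) ^ (k mod CHAR('a)) * (xi TYPE('a) ^ CHAR('a)) ^ (k div CHAR('a))"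
    by (metis mod_mult_div_eq power_add power_mult)
  then show ?thesis using xi_power_eq_1_iff[where 'a='a, of "CHAR('a)"] by simp
qed

lemma norm_xi_power [simp]: "norm (xi TYPE('a::{finite,field}) ^ k) = 1"
  by (simp add: xi_power)

definition psi :: "'a::{finite,field} \<Rightarrow> complex" where
  "psi x = xi TYPE('a) ^ fld_trace_nat x"

lemma psi_add: "psi (x + y) = psi x * psi (y::'a::{finite,field})"
  unfolding psi_def fld_trace_nat_add xi_power_mod_CHAR by (simp add: power_add)

lemma psi_0 [simp]: "psi (0::'a::{finite,field}) = 1"
  unfolding psi_def fld_trace_nat_0 by simp

lemma norm_psi [simp]: "norm (psi (x::'a::{finite,field})) = 1"
  unfolding psi_def by simp

lemma psi_nonzero [simp]: "psi (x::'a::{finite,field}) \<noteq> 0"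
  using norm_psi[of x] by (metis norm_zero zero_neq_one)

lemma cnj_mult_self_norm_1: "norm (z::complex) = 1 \<Longrightarrow> cnj z * z = 1"
  using complex_norm_square[of z] by (simp add: mult.commute)

lemma psi_uminus: "psi (- x) = cnj (psi (x::'a::{finite,field}))"
proof -
  have "psi (- x) * psi x = 1" using psi_add[of "- x" x] by simp
  moreover have "cnj (psi x) * psi x = 1" by (rule cnj_mult_self_norm_1) simp
  ultimately show ?thesis using psi_nonzero[of x] by (metis mult_cancel_right)
qed

lemma psi_diff: "psi (x - y) = psi x * cnj (psi (y::'a::{finite,field}))"
  using psi_add[of x "-y"] by (simp add: psi_uminus)

lemma ex_psi_mult_neq_1: "(c::'a::{finite,field}) \<noteq> 0 \<Longrightarrow> \<exists>t. psi (c * t) \<noteq> 1"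
proof -
  assume c: "c \<noteq> 0"
  obtain x :: 'a where x: "fld_trace x \<noteq> 0" using ex_fld_trace_nonzero by blast
  then have "fld_trace_nat x \<noteq> 0" using of_nat_fld_trace_nat[of x] by (metis of_nat_0)
  then have "\<not> CHAR('a) dvd fld_trace_nat x"
    using fld_trace_nat_less[of x] by (meson dvd_imp_le not_le neq0_conv)
  then have "psi (c * (x / c)) \<noteq> 1" using c unfolding psi_def xi_power_eq_1_iff by simp
  then show ?thesis by blast
qed


section \<open>Linear codes and duality\<close>

definition smul :: "'a::field \<Rightarrow> ('n \<Rightarrow> 'a) \<Rightarrow> ('n \<Rightarrow> 'a)" where
  "smul c x = (\<lambda>j. c * x j)"

lemma smul_of_nat_Suc: "smul (of_nat (Suc k)) a = a + smul (of_nat k) (a :: 'n \<Rightarrow> 'a::field)"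
  by (simp add: smul_def fun_eq_iff algebra_simps)

lemma smul_0_left [simp]: "smul 0 a = 0"
  by (simp add: smul_def zero_fun_def)

lemma linear_code_zero: "linear_code C \<Longrightarrow> 0 \<in> C"
  by (simp add: linear_code_def zero_fun_def)

lemma linear_code_add: "linear_code C \<Longrightarrow> x \<in> C \<Longrightarrow> y \<in> C \<Longrightarrow> x + y \<in> C"
  by (simp add: linear_code_def plus_fun_def)

lemma linear_code_smul: "linear_code C \<Longrightarrow> x \<in> C \<Longrightarrow> smul c x \<in> C"
  by (simp add: linear_code_def smul_def)

lemma linear_code_uminus:
  assumes "linear_code C" "x \<in> (C :: ('n::finite \<Rightarrow> 'a::field) set)"
  shows "- x \<in> C"
proof -
  have "smul (-1) x = - x" by (simp add: smul_def fun_eq_iff)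
  then show ?thesis using linear_code_smul[OF assms] by metis
qed

lemma linear_code_diff:
  "linear_code C \<Longrightarrow> x \<in> C \<Longrightarrow> y \<in> C \<Longrightarrow> x - y \<in> (C :: ('n::finite \<Rightarrow> 'a::field) set)"
  using linear_code_add[of C x "- y"] linear_code_uminus[of C y] by simp

lemma linear_code_Int: "linear_code A \<Longrightarrow> linear_code B \<Longrightarrow> linear_code (A \<inter> B)"
  unfolding linear_code_def by blast

lemma edot_comm: "edot x y = edot y x"
  unfolding edot_def by (simp add: mult.commute)

lemma edot_add_left: "edot (x + y) z = edot x z + edot y z"
  unfolding edot_def by (simp add: distrib_right sum.distrib)

lemma edot_add_right: "edot z (x + y) = edot z x + edot z y"
  unfolding edot_def by (simp add: distrib_left sum.distrib)

lemma edot_uminus_left: "edot (- x) z = - edot x z"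
  unfolding edot_def by (simp add: sum_negf)

lemma edot_uminus_right: "edot z (- x) = - edot z x"
  unfolding edot_def by (simp add: sum_negf)

lemma edot_diff_left: "edot (x - y) z = edot x z - edot y z"
  unfolding edot_def by (simp add: left_diff_distrib sum_subtractf)

lemma edot_diff_right: "edot z (x - y) = edot z x - edot z y"
  unfolding edot_def by (simp add: right_diff_distrib sum_subtractf)

lemma edot_smul_left: "edot (smul c x) z = c * edot x z"
  unfolding edot_def smul_def by (simp add: sum_distrib_left mult_ac)

lemma edot_smul_right: "edot z (smul c x) = c * edot z x"
  unfolding edot_def smul_def by (simp add: sum_distrib_left mult_ac)

lemma edot_0_left [simp]: "edot 0 z = 0"
  unfolding edot_def by simp

lemma edot_0_right [simp]: "edot z 0 = 0"
  unfolding edot_def by simp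

lemma linear_code_edual: "linear_code (edual C)"
  unfolding linear_code_def edual_def
  by (auto simp: edot_def distrib_right sum.distrib sum_distrib_left[symmetric] mult.assoc)

lemma edual_orth: "x \<in> edual C \<Longrightarrow> c \<in> C \<Longrightarrow> edot x c = 0"
  unfolding edual_def by blast

lemma edual_orth': "x \<in> edual C \<Longrightarrow> c \<in> C \<Longrightarrow> edot c x = 0"
  unfolding edual_def by (simp add: edot_comm)

lemma subset_edual_sym:
  assumes "A \<subseteq> edual B" shows "B \<subseteq> edual A"
  unfolding edual_def[of A] using edual_orth'[OF subsetD[OF assms]] by blast

definition supported_on :: "'n set \<Rightarrow> ('n \<Rightarrow> 'a::zero) set" where
  "supported_on J = {v. supp v \<subseteq> J}"

lemma supported_on_iff: "v \<in> supported_on J \<longleftrightarrow> (\<forall>j. j \<notin> J \<longrightarrow> v j = 0)"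
  unfolding supported_on_def supp_def by auto

lemma supported_on_UNIV [simp]: "supported_on UNIV = UNIV"
  unfolding supported_on_def by auto

lemma supported_on_mono: "I \<subseteq> J \<Longrightarrow> supported_on I \<subseteq> supported_on J"
  unfolding supported_on_def by auto

lemma linear_code_supported_on: "linear_code (supported_on J :: ('n::finite \<Rightarrow> 'a::field) set)"
  unfolding linear_code_def by (auto simp: supported_on_iff)

lemma restr_supported_on: "restr J z \<in> supported_on J"
  by (simp add: restr_def supported_on_iff)

lemma restr_supported_on_eq: "c \<in> supported_on J \<Longrightarrow> restr J c = c"
  by (auto simp: restr_def supported_on_iff fun_eq_iff)

lemma restr_restr [simp]: "restr J (restr J x) = restr J x"
  by (simp add: restr_def fun_eq_iff)

lemma restr_0 [simp]: "restr J 0 = 0"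
  by (simp add: restr_def fun_eq_iff)

lemma zero_supported_on [simp]: "0 \<in> supported_on J"
  by (simp add: supported_on_iff)

lemma diff_restr_supported_on_Compl: "(z :: 'n \<Rightarrow> 'a::ab_group_add) - restr J z \<in> supported_on (- J)"
  by (simp add: restr_def supported_on_iff)

lemma restr_add_supported_on_Compl:
  fixes x z :: "'n \<Rightarrow> 'a::ab_group_add"
  assumes "z \<in> supported_on (- J)"
  shows "restr J (x + z) = restr J x" and "restr J (x - z) = restr J x"
  using assms by (auto simp: restr_def supported_on_iff fun_eq_iff)

lemma edot_supported_on_disjoint:
  assumes "u \<in> supported_on A" "v \<in> supported_on B" "A \<inter> B = {}"
  shows "edot u (v :: 'n::finite \<Rightarrow> 'a::field) = 0"
  unfolding edot_def by (rule sum.neutral) (use assms in \<open>auto simp: supported_on_iff\<close>)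

lemma edot_supported_on_cong:
  assumes "u \<in> supported_on J" "\<forall>i\<in>J. x i = y i"
  shows "edot u x = edot u (y :: 'n::finite \<Rightarrow> 'a::field)"
  unfolding edot_def by (rule sum.cong) (use assms in \<open>auto simp: supported_on_iff\<close>)

lemma card_supported_on:
  "card (supported_on J :: ('n::finite \<Rightarrow> 'a::{finite,field}) set) = card (UNIV :: 'a set) ^ card J"
proof -
  have "bij_betw (\<lambda>v. restrict v J) (supported_on J :: ('n \<Rightarrow> 'a) set) (PiE J (\<lambda>_. UNIV))"
    by (rule bij_betw_byWitness[where f'="\<lambda>f j. if j \<in> J then f j else 0"])
       (auto simp: supported_on_iff fun_eq_iff PiE_iff extensional_def restrict_def)
  then show ?thesis by (simp add: bij_betw_same_card card_PiE)
qed

lemma sum_hom_eq_0: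
  fixes G :: "'g::ab_group_add set" and chi :: "'g \<Rightarrow> complex"
  assumes add: "\<And>g h. g \<in> G \<Longrightarrow> h \<in> G \<Longrightarrow> g + h \<in> G"
    and diff: "\<And>g h. g \<in> G \<Longrightarrow> h \<in> G \<Longrightarrow> g - h \<in> G"
    and hom: "\<And>g h. g \<in> G \<Longrightarrow> h \<in> G \<Longrightarrow> chi (g + h) = chi g * chi h"
    and g0: "g0 \<in> G" "chi g0 \<noteq> 1"
  shows "(\<Sum>g\<in>G. chi g) = 0"
proof -
  have "(\<Sum>g\<in>G. chi g) = (\<Sum>g\<in>G. chi (g + g0))"
    by (rule sum.reindex_bij_witness[where i="\<lambda>g. g + g0" and j="\<lambda>g. g - g0"])
       (auto intro: add diff g0)
  also have "\<dots> = chi g0 * (\<Sum>g\<in>G. chi g)"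
    by (simp add: sum_distrib_left hom g0 mult.commute)
  finally have "(1 - chi g0) * (\<Sum>g\<in>G. chi g) = 0" by (simp add: algebra_simps)
  then show ?thesis using g0 by simp
qed

lemma sum_psi_edot:
  fixes C :: "('n::finite \<Rightarrow> 'a::{finite,field}) set"
  assumes C: "linear_code C"
  shows "(\<Sum>c\<in>C. psi (edot c x)) = (if x \<in> edual C then of_nat (card C) else 0)"
proof (cases "x \<in> edual C")
  case True
  then show ?thesis by (simp add: edual_orth')
next
  case False
  then obtain c0 where c0: "c0 \<in> C" "edot x c0 \<noteq> 0" by (auto simp: edual_def)
  then obtain t where t: "psi (edot x c0 * t) \<noteq> 1" using ex_psi_mult_neq_1 by blast
  have "(\<Sum>c\<in>C. psi (edot c x)) = 0"
  proof (rule sum_hom_eq_0)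
    show "smul t c0 \<in> C" using linear_code_smul[OF C c0(1)] .
    have "edot (smul t c0) x = edot x c0 * t"
      using edot_smul_left[of t c0 x] edot_comm[of c0 x] by simp
    then show "psi (edot (smul t c0) x) \<noteq> 1" using t by simp
  qed (simp_all add: linear_code_add[OF C] linear_code_diff[OF C] edot_add_left psi_add)
  then show ?thesis using False by simp
qed

lemma edual_psi_trivial:
  fixes S :: "('n::finite \<Rightarrow> 'a::{finite,field}) set"
  assumes S: "linear_code S" and triv: "\<And>c. c \<in> S \<Longrightarrow> psi (edot b c) = 1"
  shows "b \<in> edual S"
  unfolding edual_def
proof (intro CollectI ballI)
  fix c assume c: "c \<in> S"
  show "edot b c = 0"
  proof (rule ccontr)
    assume "edot b c \<noteq> 0"
    then obtain t where t: "psi (edot b c * t) \<noteq> 1" using ex_psi_mult_neq_1 by blast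
    have "psi (edot b (smul t c)) = 1" by (rule triv[OF linear_code_smul[OF S c]])
    then show False using t by (simp add: edot_smul_right mult.commute)
  qed
qed

lemma supported_on_edual_eq_0:
  assumes "c \<in> supported_on J" "c \<in> edual (supported_on J)"
  shows "c = (0 :: 'n::finite \<Rightarrow> 'a::field)"
proof
  fix j
  show "c j = 0 j"
  proof (cases "j \<in> J")
    case True
    let ?e = "(\<lambda>i. if i = j then 1 else 0) :: 'n \<Rightarrow> 'a"
    have "?e \<in> supported_on J" using True by (auto simp: supported_on_iff)
    then have "edot c ?e = 0" using assms(2) edual_orth by blast
    moreover have "edot c ?e = c j" unfolding edot_def by (simp add: if_distrib cong: if_cong)
    ultimately show ?thesis by simp
  qed (use assms(1) in \<open>auto simp: supported_on_iff\<close>)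
qed

text \<open>Double counting of \<open>\<Sum>\<^sub>x\<^sub>\<in>\<^sub>V \<Sum>\<^sub>c\<^sub>\<in>\<^sub>C \<psi>(c\<cdot>x)\<close> over \<open>V = supported_on J\<close>.\<close>
lemma card_mult_card_edual_supported_on:
  fixes C :: "('n::finite \<Rightarrow> 'a::{finite,field}) set"
  assumes C: "linear_code C" and CJ: "C \<subseteq> supported_on J"
  shows "card C * card (edual C \<inter> supported_on J) = card (UNIV :: 'a set) ^ card J"
proof -
  let ?V = "supported_on J :: ('n \<Rightarrow> 'a) set"
  let ?S = "\<Sum>x\<in>?V. \<Sum>c\<in>C. psi (edot c x)"
  have "?S = (\<Sum>x\<in>?V. if x \<in> edual C then of_nat (card C) else 0)"
    using sum_psi_edot[OF C] by simp
  also have "\<dots> = of_nat (card C * card (edual C \<inter> ?V))"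
    by (simp add: sum.If_cases Int_commute)
  finally have S1: "?S = of_nat (card C * card (edual C \<inter> ?V))" .
  have "?S = (\<Sum>c\<in>C. \<Sum>x\<in>?V. psi (edot x c))"
    by (subst sum.swap) (simp add: edot_comm)
  also have "\<dots> = (\<Sum>c\<in>C. if c = 0 then of_nat (card ?V) else 0)"
  proof (rule sum.cong[OF refl])
    fix c assume "c \<in> C"
    then have "c \<in> ?V" using CJ by auto
    then show "(\<Sum>x\<in>?V. psi (edot x c)) = (if c = 0 then of_nat (card ?V) else 0)"
      using sum_psi_edot[OF linear_code_supported_on, of c J] supported_on_edual_eq_0[of c J]
      by (auto simp: edual_def)
  qed
  also have "\<dots> = of_nat (card ?V)"
    using linear_code_zero[OF C] by (simp add: sum.delta)
  finally show ?thesis using S1 card_supported_on by (metis of_nat_eq_iff)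
qed

lemma edual_edual_supported_on:
  fixes C :: "('n::finite \<Rightarrow> 'a::{finite,field}) set"
  assumes C: "linear_code C" and CJ: "C \<subseteq> supported_on J"
  shows "edual (edual C \<inter> supported_on J) \<inter> supported_on J = C"
proof -
  let ?D = "edual C \<inter> supported_on J"
  have D: "linear_code ?D" by (rule linear_code_Int[OF linear_code_edual linear_code_supported_on])
  have c1: "card C * card ?D = card (UNIV :: 'a set) ^ card J"
    by (rule card_mult_card_edual_supported_on[OF C CJ])
  have c2: "card ?D * card (edual ?D \<inter> supported_on J) = card (UNIV :: 'a set) ^ card J"
    by (rule card_mult_card_edual_supported_on[OF D]) auto
  have "card ?D > 0" using linear_code_zero[OF D] by (auto simp: card_gt_0_iff)
  then have "card (edual ?D \<inter> supported_on J) = card C" using c1 c2 by (metis mult.commute mult_left_cancel not_gr0)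
  moreover have "C \<subseteq> edual ?D \<inter> supported_on J" using CJ by (auto simp: edual_def edot_comm)
  ultimately show ?thesis using card_subset_eq by (metis finite)
qed

lemma edual_edual:
  fixes C :: "('n::finite \<Rightarrow> 'a::{finite,field}) set"
  assumes "linear_code C"
  shows "edual (edual C) = C"
  using edual_edual_supported_on[OF assms, of UNIV] by simp

lemma edual_shorten_supported_on:
  fixes C :: "('n::finite \<Rightarrow> 'a::{finite,field}) set"
  assumes C: "linear_code C"
  shows "edual (C \<inter> supported_on J) \<inter> supported_on J = restr J ` edual C"
proof -
  let ?P = "restr J ` (edual C)"
  have P: "linear_code ?P"
    unfolding linear_code_def
  proof (intro conjI ballI allI)
    show "(\<lambda>_. 0) \<in> ?P"
      using linear_code_zero[OF linear_code_edual[of C]] by (force simp: restr_def zero_fun_def)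
  next
    fix u v assume "u \<in> ?P" "v \<in> ?P"
    then obtain z w where "z \<in> edual C" "w \<in> edual C" "u = restr J z" "v = restr J w" by auto
    then show "(\<lambda>j. u j + v j) \<in> ?P"
      using linear_code_add[OF linear_code_edual, of z C w]
      by (intro image_eqI[of _ _ "z + w"]) (auto simp: restr_def)
  next
    fix c u assume "u \<in> ?P"
    then obtain z where "z \<in> edual C" "u = restr J z" by auto
    then show "(\<lambda>j. c * u j) \<in> ?P"
      using linear_code_smul[OF linear_code_edual, of z C c]
      by (intro image_eqI[of _ _ "smul c z"]) (auto simp: restr_def smul_def)
  qed
  have "edual ?P \<inter> supported_on J = C \<inter> supported_on J"
  proof -
    have "v \<in> edual ?P \<longleftrightarrow> v \<in> edual (edual C)" if "v \<in> supported_on J" for v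
      using edot_supported_on_cong[OF that, of "restr J z" z for z]
      by (auto simp: edual_def restr_def)
    then show ?thesis using edual_edual[OF C] by auto
  qed
  moreover have "edual (edual ?P \<inter> supported_on J) \<inter> supported_on J = ?P"
    by (rule edual_edual_supported_on[OF P]) (auto simp: restr_supported_on)
  ultimately show ?thesis by simp
qed

lemma shorten_eq_Int_supported_on:
  fixes X :: "('n \<Rightarrow> 'a::zero) set"
  shows "shorten I X = X \<inter> supported_on I"
proof -
  have "restr I c = c" if "supp c \<subseteq> I" for c :: "'n \<Rightarrow> 'a"
    using that restr_supported_on_eq by (simp add: supported_on_def)
  then show ?thesis unfolding shorten_def supported_on_def by auto metis
qed

lemma puncture_eq_image: "puncture J X = restr J ` X"
  unfolding puncture_def by auto

lemma shorten_puncture_edual_eq_iff: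
  fixes Cx Cy :: "('n::finite \<Rightarrow> 'a::field) set"
  assumes IJ: "I \<subseteq> J" and Cy: "Cy \<subseteq> edual Cx"
  shows "shorten I (puncture J (edual Cx)) = shorten I Cy \<longleftrightarrow>
         (\<forall>z\<in>edual Cx. restr J z \<in> supported_on I \<longrightarrow> restr J z \<in> Cy)"
proof -
  have "c \<in> restr J ` edual Cx" if "c \<in> Cy \<inter> supported_on I" for c
    using that Cy restr_supported_on_eq supported_on_mono[OF IJ] by (metis IntE image_eqI subsetD)
  then show ?thesis
    unfolding shorten_eq_Int_supported_on puncture_eq_image by blast
qed


section \<open>Operators and Pauli operators\<close>

lemma prod_psi: "finite A \<Longrightarrow> (\<Prod>j\<in>A. psi (f j)) = psi (\<Sum>j\<in>A. f j :: 'a::{finite,field})"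
  by (induction A rule: finite_induct) (auto simp: psi_add)

lemma prod_if_all:
  "finite A \<Longrightarrow> (\<Prod>j\<in>A. if P j then f j else (0::complex)) = (if \<forall>j\<in>A. P j then \<Prod>j\<in>A. f j else 0)"
  by (induction A rule: finite_induct) auto

lemma Eop_apply: "Eop a b x y = (if x = y + a then psi (edot b y) else 0)"
proof -
  have "Eop a b x y = (\<Prod>j\<in>UNIV. if x j = y j + a j then psi (b j * y j) else 0)"
    unfolding Eop_def XZ1_def psi_def by simp
  also have "\<dots> = (if x = y + a then psi (edot b y) else 0)"
    by (simp add: prod_if_all prod_psi edot_def fun_eq_iff)
  finally show ?thesis .
qed

lemma sum_apply2: "(\<Sum>k\<in>K. A k) x y = (\<Sum>k\<in>K. A k x y)"
  by (induction K rule: infinite_finite_induct) auto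

lemma op_mult_assoc: "op_mult (op_mult A B) C = op_mult A (op_mult B C)"
proof (intro ext)
  fix x y
  have "op_mult (op_mult A B) C x y = (\<Sum>z\<in>UNIV. \<Sum>w\<in>UNIV. A x w * B w z * C z y)"
    unfolding op_mult_def by (simp add: sum_distrib_right)
  also have "\<dots> = (\<Sum>w\<in>UNIV. \<Sum>z\<in>UNIV. A x w * B w z * C z y)" by (rule sum.swap)
  also have "\<dots> = op_mult A (op_mult B C) x y"
    unfolding op_mult_def by (simp add: sum_distrib_left mult.assoc)
  finally show "op_mult (op_mult A B) C x y = op_mult A (op_mult B C) x y" .
qed

lemma op_app_mult: "op_app (op_mult A B) v = op_app A (op_app B v)"
proof (intro ext)
  fix x
  have "op_app (op_mult A B) v x = (\<Sum>z\<in>UNIV. \<Sum>w\<in>UNIV. A x w * B w z * v z)"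
    unfolding op_mult_def op_app_def by (simp add: sum_distrib_right)
  also have "\<dots> = (\<Sum>w\<in>UNIV. \<Sum>z\<in>UNIV. A x w * B w z * v z)" by (rule sum.swap)
  also have "\<dots> = op_app A (op_app B v) x"
    unfolding op_app_def by (simp add: sum_distrib_left mult.assoc)
  finally show "op_app (op_mult A B) v x = op_app A (op_app B v) x" .
qed

lemma op_mult_scal_left: "op_mult (op_scal c A) B = op_scal c (op_mult A B)"
  unfolding op_mult_def op_scal_def by (intro ext) (simp add: sum_distrib_left mult.assoc)

lemma op_mult_scal_right: "op_mult A (op_scal c B) = op_scal c (op_mult A B)"
  unfolding op_mult_def op_scal_def by (intro ext) (simp add: sum_distrib_left mult_ac)

lemma op_scal_scal: "op_scal c (op_scal d A) = op_scal (c * d) A"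
  unfolding op_scal_def by (intro ext) (simp add: mult.assoc)

lemma op_scal_1 [simp]: "op_scal 1 A = A"
  unfolding op_scal_def by simp

lemma op_app_scal: "op_app (op_scal c A) v = (\<lambda>x. c * op_app A v x)"
  unfolding op_app_def op_scal_def by (intro ext) (simp add: sum_distrib_left mult.assoc)

lemma op_app_cmult: "op_app A (\<lambda>x. c * v x) = (\<lambda>x. c * op_app A v x)"
  unfolding op_app_def by (intro ext) (simp add: sum_distrib_left mult_ac)

lemma op_app_0: "op_app A (\<lambda>x. 0) = (\<lambda>x. 0)"
  unfolding op_app_def by simp

lemma op_mult_id_left [simp]: "op_mult op_id A = A"
  unfolding op_mult_def op_id_def by (intro ext) (simp flip: of_bool_def)

lemma op_mult_id_right [simp]: "op_mult A op_id = A"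
  unfolding op_mult_def op_id_def by (intro ext) (simp flip: of_bool_def)

lemma op_app_id [simp]: "op_app op_id v = v"
  unfolding op_app_def op_id_def by (intro ext) (simp flip: of_bool_def)

lemma op_adj_mult: "op_adj (op_mult A B) = op_mult (op_adj B) (op_adj A)"
  unfolding op_adj_def op_mult_def by (intro ext) (simp add: mult.commute)

lemma op_adj_scal: "op_adj (op_scal c A) = op_scal (cnj c) (op_adj A)"
  unfolding op_adj_def op_scal_def by simp

lemma op_adj_id [simp]: "op_adj op_id = op_id"
  unfolding op_adj_def op_id_def by (intro ext) auto

lemma op_mult_sum_left: "op_mult (\<Sum>k\<in>K. A k) B = (\<Sum>k\<in>K. op_mult (A k) B)"
  unfolding op_mult_def by (intro ext) (simp add: sum_apply2 sum_distrib_right sum.swap[of _ UNIV K])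

lemma op_mult_sum_right: "op_mult B (\<Sum>k\<in>K. A k) = (\<Sum>k\<in>K. op_mult B (A k))"
  unfolding op_mult_def by (intro ext) (simp add: sum_apply2 sum_distrib_left sum.swap[of _ UNIV K])

lemma op_mult_diff_left: "op_mult (A - B) C = op_mult A C - op_mult B C"
  unfolding op_mult_def by (intro ext) (simp add: left_diff_distrib sum_subtractf)

lemma op_mult_diff_right: "op_mult C (A - B) = op_mult C A - op_mult C B"
  unfolding op_mult_def by (intro ext) (simp add: right_diff_distrib sum_subtractf)

lemma op_adj_sum: "op_adj (\<Sum>k\<in>K. A k) = (\<Sum>k\<in>K. op_adj (A k))"
  unfolding op_adj_def by (intro ext) (simp add: sum_apply2)

lemma op_adj_diff: "op_adj (A - B) = op_adj A - op_adj B"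
  unfolding op_adj_def by (intro ext) simp

lemma op_app_sum: "op_app (\<Sum>k\<in>K. A k) v = (\<lambda>x. \<Sum>k\<in>K. op_app (A k) v x)"
  unfolding op_app_def by (intro ext) (simp add: sum_apply2 sum_distrib_right sum.swap[of _ UNIV K])

lemma op_app_diff: "op_app (A - B) v = (\<lambda>x. op_app A v x - op_app B v x)"
  unfolding op_app_def by (intro ext) (simp add: left_diff_distrib sum_subtractf)

lemma op_scal_sum: "op_scal c (\<Sum>k\<in>K. A k) = (\<Sum>k\<in>K. op_scal c (A k))"
  unfolding op_scal_def by (intro ext) (simp add: sum_apply2 sum_distrib_left)

lemma sum_op_scal: "(\<Sum>k\<in>K. op_scal (f k) A) = op_scal (\<Sum>k\<in>K. f k) A"
  unfolding op_scal_def by (intro ext) (simp add: sum_apply2 sum_distrib_right)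

lemma op_scal_0 [simp]: "op_scal 0 A = 0"
  unfolding op_scal_def by (simp add: zero_fun_def)

lemma op_adj_adj [simp]: "op_adj (op_adj A) = A"
  unfolding op_adj_def by simp

lemma Eop_mult: "op_mult (Eop a b) (Eop c d) = op_scal (psi (edot b c)) (Eop (a + c) (b + d))"
proof (intro ext)
  fix x y
  have "op_mult (Eop a b) (Eop c d) x y
      = (\<Sum>z\<in>UNIV. if z = y + c then (if x = z + a then psi (edot b z) else 0) * psi (edot d y) else 0)"
    unfolding op_mult_def Eop_apply by (intro sum.cong) auto
  also have "\<dots> = (if x = y + c + a then psi (edot b (y + c)) else 0) * psi (edot d y)"
    by simp
  also have "\<dots> = op_scal (psi (edot b c)) (Eop (a + c) (b + d)) x y"
    unfolding op_scal_def Eop_apply by (simp add: edot_add_left edot_add_right psi_add add_ac mult_ac)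
  finally show "op_mult (Eop a b) (Eop c d) x y = op_scal (psi (edot b c)) (Eop (a + c) (b + d)) x y" .
qed

lemma op_app_Eop: "op_app (Eop a b) v = (\<lambda>x. psi (edot b (x - a)) * v (x - a))"
proof (intro ext)
  fix x
  have "op_app (Eop a b) v x = (\<Sum>z\<in>UNIV. if z = x - a then psi (edot b z) * v z else 0)"
    unfolding op_app_def Eop_apply by (intro sum.cong) (auto simp: algebra_simps)
  then show "op_app (Eop a b) v x = psi (edot b (x - a)) * v (x - a)" by simp
qed

lemma op_adj_Eop: "op_adj (Eop a b) = op_scal (psi (edot a b)) (Eop (- a) (- b))"
proof -
  have "edot a b + edot (- b) (x + a) = - edot b x" for x
    by (simp add: edot_uminus_left edot_add_right edot_comm[of b a])
  then have "cnj (psi (edot b x)) = psi (edot a b) * psi (edot (- b) (x + a))" for x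
    by (metis psi_add psi_uminus)
  then show ?thesis
    unfolding op_adj_def op_scal_def Eop_apply by (intro ext) (auto simp: algebra_simps)
qed

lemma Eop_0_0: "Eop 0 0 = op_id"
  by (intro ext) (simp add: Eop_apply op_id_def)

lemma Eop_mult_adj: "op_mult (Eop a b) (op_adj (Eop a b)) = op_id"
proof -
  have "psi (edot a b) * psi (edot b (- a)) = 1"
    by (simp add: edot_uminus_right edot_comm[of b a] flip: psi_add)
  then show ?thesis by (simp add: op_adj_Eop op_mult_scal_right Eop_mult op_scal_scal Eop_0_0)
qed

lemma op_app_adj_Eop: "op_app (op_adj (Eop a b)) (op_app (Eop a b) v) = v"
proof -
  have "psi (edot a b) * psi (edot (- b) a) = 1"
    by (simp add: edot_uminus_left edot_comm[of b a] flip: psi_add)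
  then have "op_mult (op_adj (Eop a b)) (Eop a b) = op_id"
    by (simp add: op_adj_Eop op_mult_scal_left Eop_mult op_scal_scal Eop_0_0)
  then show ?thesis by (metis op_app_mult op_app_id)
qed

lemma op_conj_ketbra: "op_mult (op_mult A (ketbra v)) (op_adj A) = ketbra (op_app A v)"
  unfolding op_mult_def ketbra_def op_adj_def op_app_def
  by (intro ext) (simp add: sum_distrib_left sum_distrib_right mult_ac)

lemma ketbra_0 [simp]: "ketbra (\<lambda>x. 0) = 0"
  unfolding ketbra_def by (simp add: zero_fun_def)

lemma ketbra_cmult_norm_1: "norm c = 1 \<Longrightarrow> ketbra (\<lambda>x. c * \<phi> x) = ketbra \<phi>"
  unfolding ketbra_def using cnj_mult_self_norm_1[of c] by (intro ext) (simp add: mult_ac)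


section \<open>Operators acting on the qudits in a set\<close>

definition local_on :: "'n set \<Rightarrow> ('n::finite, 'a::{finite,field}) qop \<Rightarrow> bool" where
  "local_on J A \<longleftrightarrow>
     (\<forall>x y. A x y = (if \<forall>i. i \<notin> J \<longrightarrow> x i = y i then A (restr J x) (restr J y) else 0))"

lemma local_onD:
  "local_on J A \<Longrightarrow> A x y = (if \<forall>i. i \<notin> J \<longrightarrow> x i = y i then A (restr J x) (restr J y) else 0)"
  unfolding local_on_def by blast

lemma local_op_eq_self: "local_on J A \<Longrightarrow> local_op J A = A"
  unfolding local_op_def by (intro ext) (simp add: local_onD[symmetric])

lemma local_on_Eop:
  fixes a b :: "'n::finite \<Rightarrow> 'a::{finite,field}"
  assumes a: "a \<in> supported_on J" and b: "b \<in> supported_on J"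
  shows "local_on J (Eop a b)"
  unfolding local_on_def
proof (intro allI)
  fix x y :: "'n \<Rightarrow> 'a"
  have "edot b (restr J y) = edot b y"
    by (rule edot_supported_on_cong[OF b]) (simp add: restr_def)
  moreover have "restr J x = restr J y + a \<longleftrightarrow> x = y + a" if agree: "\<forall>i. i \<notin> J \<longrightarrow> x i = y i"
  proof -
    have "restr J x i = (restr J y + a) i \<longleftrightarrow> x i = (y + a) i" for i
      using agree a by (cases "i \<in> J") (auto simp: restr_def supported_on_iff)
    then show ?thesis unfolding fun_eq_iff by blast
  qed
  moreover have "x \<noteq> y + a" if "\<not> (\<forall>i. i \<notin> J \<longrightarrow> x i = y i)"
    using that a by (auto simp: supported_on_iff)
  ultimately show "Eop a b x y = (if \<forall>i. i \<notin> J \<longrightarrow> x i = y i then Eop a b (restr J x) (restr J y) else 0)"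
    unfolding Eop_apply by auto
qed

lemma local_on_id: "local_on J (op_id :: ('n::finite, 'a::{finite,field}) qop)"
  using local_on_Eop[of 0 J 0] by (simp add: Eop_0_0 supported_on_iff)

lemma local_on_adj:
  fixes A :: "('n::finite, 'a::{finite,field}) qop"
  assumes "local_on J A" shows "local_on J (op_adj A)"
  unfolding local_on_def op_adj_def
proof (intro allI)
  fix x y :: "'n \<Rightarrow> 'a"
  have "(\<forall>i. i \<notin> J \<longrightarrow> y i = x i) = (\<forall>i. i \<notin> J \<longrightarrow> x i = y i)" by auto
  then show "cnj (A y x) = (if \<forall>i. i \<notin> J \<longrightarrow> x i = y i then cnj (A (restr J y) (restr J x)) else 0)"
    using local_onD[OF assms, of y x] by auto
qed

lemma local_on_scal:
  fixes A :: "('n::finite, 'a::{finite,field}) qop"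
  assumes "local_on J A" shows "local_on J (op_scal c A)"
  unfolding local_on_def op_scal_def
proof (intro allI)
  fix x y :: "'n \<Rightarrow> 'a"
  show "c * A x y = (if \<forall>i. i \<notin> J \<longrightarrow> x i = y i then c * A (restr J x) (restr J y) else 0)"
    using local_onD[OF assms, of x y] by auto
qed

lemma local_on_diff:
  fixes A B :: "('n::finite, 'a::{finite,field}) qop"
  assumes "local_on J A" "local_on J B" shows "local_on J (A - B)"
  unfolding local_on_def
proof (intro allI)
  fix x y :: "'n \<Rightarrow> 'a"
  show "(A - B) x y = (if \<forall>i. i \<notin> J \<longrightarrow> x i = y i then (A - B) (restr J x) (restr J y) else 0)"
    using local_onD[OF assms(1), of x y] local_onD[OF assms(2), of x y] by auto
qed

lemma local_on_add:
  fixes A B :: "('n::finite, 'a::{finite,field}) qop"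
  assumes "local_on J A" "local_on J B" shows "local_on J (A + B)"
  unfolding local_on_def
proof (intro allI)
  fix x y :: "'n \<Rightarrow> 'a"
  show "(A + B) x y = (if \<forall>i. i \<notin> J \<longrightarrow> x i = y i then (A + B) (restr J x) (restr J y) else 0)"
    using local_onD[OF assms(1), of x y] local_onD[OF assms(2), of x y] by auto
qed

lemma local_on_sum: "(\<And>k. k \<in> K \<Longrightarrow> local_on J (A k)) \<Longrightarrow> local_on J (\<Sum>k\<in>K. A k)"
proof (induction K rule: infinite_finite_induct)
  case (insert k K)
  then show ?case unfolding sum.insert[OF insert(1,2)] by (intro local_on_add) auto
qed (simp_all add: local_on_def)

lemma local_on_apply_translate:
  assumes A: "local_on J A" and k: "k \<in> supported_on (- J)"
  shows "A (x + k) (y + k) = A x y"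
proof -
  have agree: "(\<forall>i. i \<notin> J \<longrightarrow> (x + k) i = (y + k) i) \<longleftrightarrow> (\<forall>i. i \<notin> J \<longrightarrow> x i = y i)" by simp
  show ?thesis
    by (simp only: local_onD[OF A, of "x + k" "y + k"] local_onD[OF A, of x y] agree
        restr_add_supported_on_Compl(1)[OF k])
qed

lemma local_on_mult:
  fixes A B :: "('n::finite, 'a::{finite,field}) qop"
  assumes A: "local_on J A" and B: "local_on J B"
  shows "local_on J (op_mult A B)"
  unfolding local_on_def
proof (intro allI)
  fix x y :: "'n \<Rightarrow> 'a"
  let ?agree = "\<lambda>(u :: 'n \<Rightarrow> 'a) v. \<forall>i. i \<notin> J \<longrightarrow> u i = v i"
  show "op_mult A B x y = (if ?agree x y then op_mult A B (restr J x) (restr J y) else 0)"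
  proof (cases "?agree x y")
    case False
    have "A x z * B z y = 0" for z
      using False local_onD[OF A, of x z] local_onD[OF B, of z y] by auto
    then have "op_mult A B x y = 0" unfolding op_mult_def by (intro sum.neutral) blast
    then show ?thesis using False by auto
  next
    case True
    define k where "k = x - restr J x"
    have k: "k \<in> supported_on (- J)" unfolding k_def by (rule diff_restr_supported_on_Compl)
    have x: "restr J x + k = x" and y: "restr J y + k = y"
      using True by (auto simp: k_def restr_def fun_eq_iff)
    have "op_mult A B (restr J x) (restr J y) = (\<Sum>z\<in>UNIV. A x (z + k) * B (z + k) y)"
      unfolding op_mult_def
      using local_on_apply_translate[OF A k, of "restr J x"] local_on_apply_translate[OF B k, of _ "restr J y"]
      by (simp add: x y)
    also have "\<dots> = op_mult A B x y"
      unfolding op_mult_def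
      by (rule sum.reindex_bij_witness[where i="\<lambda>z. z - k" and j="\<lambda>z. z + k"]) auto
    finally show ?thesis using True by simp
  qed
qed

lemma op_app_local_op_phase:
  fixes B :: "('n::finite, 'a::{finite,field}) qop"
  assumes z: "z \<in> supported_on (- J)"
  shows "op_app (local_op J B) (\<lambda>x. psi (edot z x) * v x)
       = (\<lambda>x. psi (edot z x) * op_app (local_op J B) v x)"
  unfolding op_app_def sum_distrib_left
proof (intro ext sum.cong refl)
  fix x y :: "'n \<Rightarrow> 'a"
  have "edot z x = edot z y" if "\<forall>i. i \<notin> J \<longrightarrow> x i = y i"
    using edot_supported_on_cong[OF z] that by simp
  then show "local_op J B x y * (psi (edot z y) * v y) = psi (edot z x) * (local_op J B x y * v y)"
    by (auto simp: local_op_def)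
qed

lemma op_app_local_op_shift:
  fixes B :: "('n::finite, 'a::{finite,field}) qop"
  assumes z: "z \<in> supported_on (- J)"
  shows "op_app (local_op J B) (\<lambda>x. v (x - z)) = (\<lambda>x. op_app (local_op J B) v (x - z))"
  unfolding op_app_def
proof (intro ext)
  fix x
  have "(\<Sum>y\<in>UNIV. local_op J B x y * v (y - z)) = (\<Sum>y\<in>UNIV. local_op J B x (y + z) * v y)"
    by (rule sum.reindex_bij_witness[where i="\<lambda>y. y + z" and j="\<lambda>y. y - z"]) auto
  also have "\<dots> = (\<Sum>y\<in>UNIV. local_op J B (x - z) y * v y)"
  proof (intro sum.cong refl)
    fix y
    have "(\<forall>i. i \<notin> J \<longrightarrow> x i = (y + z) i) = (\<forall>i. i \<notin> J \<longrightarrow> (x - z) i = y i)"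
      by (auto simp: algebra_simps)
    then show "local_op J B x (y + z) * v y = local_op J B (x - z) y * v y"
      unfolding local_op_def restr_add_supported_on_Compl[OF z] by simp
  qed
  finally show "(\<Sum>y\<in>UNIV. local_op J B x y * v (y - z)) = (\<Sum>y\<in>UNIV. local_op J B (x - z) y * v y)" .
qed

lemma op_app_local_op_Eop:
  fixes B :: "('n::finite, 'a::{finite,field}) qop"
  assumes c: "c \<in> supported_on (- J)" and d: "d \<in> supported_on (- J)"
  shows "op_app (local_op J B) (op_app (Eop c d) v) = op_app (Eop c d) (op_app (local_op J B) v)"
proof -
  have E: "op_app (Eop c d) u = (\<lambda>x. psi (edot d x) * (cnj (psi (edot d c)) * u (x - c)))" for u
    by (simp add: op_app_Eop edot_diff_right psi_diff mult_ac)
  show ?thesis by (simp add: E op_app_local_op_phase[OF d] op_app_cmult op_app_local_op_shift[OF c])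
qed

lemma local_on_local_op: "local_on J (local_op J B)"
proof -
  have "\<forall>i. i \<notin> J \<longrightarrow> restr J x i = restr J y i" for x y :: "'a \<Rightarrow> 'b" by (simp add: restr_def)
  then show ?thesis by (auto simp: local_on_def local_op_def)
qed

lemma op_app_local_on_Eop:
  assumes L: "local_on J L" and c: "c \<in> supported_on (- J)" and d: "d \<in> supported_on (- J)"
  shows "op_app L (op_app (Eop c d) v) = op_app (Eop c d) (op_app L v)"
  using op_app_local_op_Eop[OF c d, of L v] by (simp add: local_op_eq_self[OF L])


section \<open>Isotypic projections of a unitary representation\<close>

locale unitary_rep =
  fixes G :: "'g::ab_group_add set" and U :: "'g \<Rightarrow> ('n::finite, 'a::{finite,field}) qop"
  assumes finite_G: "finite G" and zero_in_G: "0 \<in> G"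
    and add_in_G: "\<And>g h. g \<in> G \<Longrightarrow> h \<in> G \<Longrightarrow> g + h \<in> G"
    and uminus_in_G: "\<And>g. g \<in> G \<Longrightarrow> - g \<in> G"
    and U_add: "\<And>g h. g \<in> G \<Longrightarrow> h \<in> G \<Longrightarrow> op_mult (U g) (U h) = U (g + h)"
    and U_adj: "\<And>g. g \<in> G \<Longrightarrow> op_adj (U g) = U (- g)"
begin

lemma diff_in_G: "g \<in> G \<Longrightarrow> h \<in> G \<Longrightarrow> g - h \<in> G"
  using add_in_G uminus_in_G by (metis diff_conv_add_uminus)

lemma card_G_pos: "card G > 0"
  using finite_G zero_in_G by (auto simp: card_gt_0_iff)

definition is_char :: "('g \<Rightarrow> complex) \<Rightarrow> bool" where
  "is_char s \<longleftrightarrow> (\<forall>g\<in>G. \<forall>h\<in>G. s (g + h) = s g * s h) \<and> (\<forall>g\<in>G. norm (s g) = 1)"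

definition char_proj :: "('g \<Rightarrow> complex) \<Rightarrow> ('n, 'a) qop" where
  "char_proj s = op_scal (1 / of_nat (card G)) (\<Sum>g\<in>G. op_scal (cnj (s g)) (U g))"

lemma is_char_diff:
  assumes s: "is_char s" and g: "g \<in> G" and h: "h \<in> G"
  shows "s (g - h) = s g * cnj (s h)"
proof -
  have "s g = s (g - h) * s h" using s diff_in_G[OF g h] h unfolding is_char_def by (metis diff_add_cancel)
  then have "s g * cnj (s h) = s (g - h) * (cnj (s h) * s h)" by (simp add: mult_ac)
  then show ?thesis using s h cnj_mult_self_norm_1 unfolding is_char_def by simp
qed

lemma is_char_0: "is_char s \<Longrightarrow> s 0 = 1"
  using is_char_diff[of s 0 0] zero_in_G cnj_mult_self_norm_1[of "s 0"]
  by (auto simp: is_char_def mult.commute)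

lemma is_char_uminus: "is_char s \<Longrightarrow> g \<in> G \<Longrightarrow> s (- g) = cnj (s g)"
  using is_char_diff[of s 0 g] is_char_0 zero_in_G by simp

lemma sum_cnj_char_mult_char:
  assumes s: "is_char s" and t: "is_char t"
  shows "(\<Sum>g\<in>G. cnj (t g) * s g) = (if \<forall>g\<in>G. s g = t g then of_nat (card G) else 0)"
proof (cases "\<forall>g\<in>G. s g = t g")
  case True
  then show ?thesis using t cnj_mult_self_norm_1 by (simp add: is_char_def)
next
  case False
  then obtain g0 where g0: "g0 \<in> G" "s g0 \<noteq> t g0" by blast
  have "cnj (t g0) * s g0 \<noteq> 1"
  proof
    assume "cnj (t g0) * s g0 = 1"
    then have "(t g0 * cnj (t g0)) * s g0 = t g0" by (simp add: mult.assoc)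
    moreover have "t g0 * cnj (t g0) = 1"
      using g0(1) t cnj_mult_self_norm_1 by (simp add: is_char_def mult.commute)
    ultimately show False using g0(2) by simp
  qed
  then have "(\<Sum>g\<in>G. cnj (t g) * s g) = 0"
    using s t g0 by (intro sum_hom_eq_0[OF add_in_G diff_in_G]) (auto simp: is_char_def mult_ac)
  then show ?thesis using False by auto
qed

lemma char_proj_adj: "is_char s \<Longrightarrow> op_adj (char_proj s) = char_proj s"
proof -
  assume s: "is_char s"
  have "(\<Sum>g\<in>G. op_scal (s g) (U (- g))) = (\<Sum>g\<in>G. op_scal (s (- g)) (U g))"
    by (rule sum.reindex_bij_witness[where i=uminus and j=uminus]) (auto intro: uminus_in_G)
  also have "\<dots> = (\<Sum>g\<in>G. op_scal (cnj (s g)) (U g))"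
    by (intro sum.cong refl) (simp add: is_char_uminus[OF s])
  finally show ?thesis
    unfolding char_proj_def by (simp add: op_adj_scal op_adj_sum U_adj cong: sum.cong)
qed

lemma char_proj_mult_U:
  assumes s: "is_char s" and h: "h \<in> G"
  shows "op_mult (char_proj s) (U h) = op_scal (s h) (char_proj s)"
proof -
  let ?c = "1 / of_nat (card G) :: complex"
  have "op_mult (char_proj s) (U h) = op_scal ?c (\<Sum>g\<in>G. op_scal (cnj (s g)) (U (g + h)))"
    unfolding char_proj_def by (simp add: op_mult_scal_left op_mult_sum_left U_add h cong: sum.cong)
  also have "(\<Sum>g\<in>G. op_scal (cnj (s g)) (U (g + h))) = (\<Sum>k\<in>G. op_scal (cnj (s (k - h))) (U k))"
    by (rule sum.reindex_bij_witness[where i="\<lambda>k. k - h" and j="\<lambda>g. g + h"])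
       (auto intro: add_in_G diff_in_G h)
  also have "\<dots> = op_scal (s h) (\<Sum>k\<in>G. op_scal (cnj (s k)) (U k))"
    unfolding op_scal_sum
    by (intro sum.cong refl) (simp add: is_char_diff[OF s _ h] op_scal_scal mult.commute)
  finally show ?thesis unfolding char_proj_def by (simp add: op_scal_scal mult.commute)
qed

lemma char_proj_mult:
  assumes s: "is_char s" and t: "is_char t"
  shows "op_mult (char_proj s) (char_proj t) = (if \<forall>g\<in>G. s g = t g then char_proj s else 0)"
proof -
  have "op_mult (char_proj s) (char_proj t)
      = op_scal (1 / of_nat (card G)) (\<Sum>h\<in>G. op_scal (cnj (t h) * s h) (char_proj s))"
    unfolding char_proj_def[of t]
    by (simp add: op_mult_scal_right op_mult_sum_right char_proj_mult_U[OF s] op_scal_scal cong: sum.cong)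
  also have "\<dots> = (if \<forall>g\<in>G. s g = t g then char_proj s else 0)"
    using card_G_pos by (simp add: sum_op_scal op_scal_scal sum_cnj_char_mult_char[OF s t])
  finally show ?thesis .
qed

lemma char_proj_app:
  assumes s: "is_char s" and chi: "is_char chi"
    and w: "\<And>g. g \<in> G \<Longrightarrow> op_app (U g) w = (\<lambda>x. chi g * w x)"
  shows "op_app (char_proj s) w = (if \<forall>g\<in>G. chi g = s g then w else (\<lambda>x. 0))"
proof -
  have "op_app (char_proj s) w = (\<lambda>x. (1 / of_nat (card G)) * (\<Sum>g\<in>G. cnj (s g) * chi g) * w x)"
    unfolding char_proj_def
    by (simp add: op_app_scal op_app_sum w sum_distrib_left sum_distrib_right mult_ac cong: sum.cong)
  then show ?thesis using card_G_pos by (simp add: sum_cnj_char_mult_char[OF chi s])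
qed

lemma kraus_completeness:
  fixes Ss :: "('g \<Rightarrow> complex) set" and V :: "('g \<Rightarrow> complex) \<Rightarrow> ('n, 'a) qop"
  assumes fin: "finite Ss" and ch: "\<And>s. s \<in> Ss \<Longrightarrow> is_char s"
    and dist: "\<And>s t. s \<in> Ss \<Longrightarrow> t \<in> Ss \<Longrightarrow> \<forall>g\<in>G. s g = t g \<Longrightarrow> s = t"
    and unit: "\<And>s. s \<in> Ss \<Longrightarrow> op_mult (V s) (op_adj (V s)) = op_id"
  defines "P \<equiv> (\<Sum>s\<in>Ss. char_proj s)"
  shows "(\<Sum>s\<in>Ss. op_mult (op_adj (op_mult (op_adj (V s)) (char_proj s))) (op_mult (op_adj (V s)) (char_proj s)))
         + op_mult (op_adj (op_id - P)) (op_id - P) = op_id"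
proof -
  have A: "op_mult (op_adj (op_mult (op_adj (V s)) (char_proj s))) (op_mult (op_adj (V s)) (char_proj s))
      = char_proj s" if s: "s \<in> Ss" for s
  proof -
    have "op_mult (op_adj (op_mult (op_adj (V s)) (char_proj s))) (op_mult (op_adj (V s)) (char_proj s))
        = op_mult (char_proj s) (op_mult (op_mult (V s) (op_adj (V s))) (char_proj s))"
      by (simp add: op_adj_mult char_proj_adj[OF ch[OF s]] op_mult_assoc)
    then show ?thesis using unit[OF s] char_proj_mult[OF ch[OF s] ch[OF s]] by simp
  qed
  have P_adj: "op_adj P = P" unfolding P_def by (simp add: op_adj_sum char_proj_adj ch)
  have "op_mult P P = (\<Sum>t\<in>Ss. \<Sum>s\<in>Ss. if s = t then char_proj t else 0)"
    unfolding P_def op_mult_sum_left op_mult_sum_right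
    using char_proj_mult ch dist by (intro sum.cong refl) auto
  then have P_idem: "op_mult P P = P" unfolding P_def using fin by simp
  show ?thesis
    by (simp add: A P_def[symmetric] op_adj_diff P_adj op_mult_diff_left op_mult_diff_right P_idem
        flip: P_def cong: sum.cong)
qed

end


section \<open>Local recoverability\<close>

lemma inverse_square_power_mult_of_nat:
  "N > 0 \<Longrightarrow> ((1 / of_nat N) ^ 2) ^ k * of_nat (N ^ k * N ^ k) = (1::complex)"
proof -
  assume "N > 0"
  then have "((1 / of_nat N) ^ 2 * of_nat N ^ 2 :: complex) = 1" by (simp add: field_simps)
  then have "(((1 / of_nat N) ^ 2 * of_nat N ^ 2) ^ k :: complex) = 1" by simp
  then show ?thesis by (simp only: power_mult_distrib of_nat_mult of_nat_power power2_eq_square power_mult)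
qed

lemma card_errors:
  "card (supported_on I \<times> supported_on I :: (('n::finite \<Rightarrow> 'a::{finite,field}) \<times> ('n \<Rightarrow> 'a)) set)
     = card (UNIV :: 'a set) ^ card I * card (UNIV :: 'a set) ^ card I"
  by (simp add: card_cartesian_product card_supported_on)

lemma Gamma_I_ketbra:
  fixes \<phi> :: "('n::finite, 'a::{finite,field}) qvec"
  shows "Gamma_I I (ketbra \<phi>) = op_scal (((1 / of_nat (card (UNIV :: 'a set))) ^ 2) ^ card I)
           (\<Sum>(a, b)\<in>supported_on I \<times> supported_on I. ketbra (op_app (Eop a b) \<phi>))"
  unfolding Gamma_I_def op_scal_def supported_on_def
  by (intro ext) (simp add: op_conj_ketbra case_prod_beta sum_apply2 power_one_over)

lemma kraus_Gamma_I_ketbra: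
  fixes L :: "'k \<Rightarrow> ('n::finite, 'a::{finite,field}) qop"
  assumes R: "\<And>rho. R rho = (\<lambda>x y. \<Sum>k\<in>K. op_mult (op_mult (L k) rho) (op_adj (L k)) x y)"
  shows "R (Gamma_I I (ketbra \<phi>)) = op_scal (((1 / of_nat (card (UNIV :: 'a set))) ^ 2) ^ card I)
           (\<Sum>(a, b)\<in>supported_on I \<times> supported_on I. \<Sum>k\<in>K. ketbra (op_app (L k) (op_app (Eop a b) \<phi>)))"
proof -
  have "R rho = (\<Sum>k\<in>K. op_mult (op_mult (L k) rho) (op_adj (L k)))" for rho
    unfolding R by (intro ext) (simp add: sum_apply2)
  then show ?thesis
    unfolding Gamma_I_ketbra
    by (simp add: op_mult_scal_left op_mult_scal_right op_mult_sum_left op_mult_sum_right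
        op_conj_ketbra op_scal_sum case_prod_beta sum.swap[of _ K])
qed

lemma sum_weighted_norm_eq_0D:
  fixes s :: "'i \<Rightarrow> complex" and t :: real
  assumes S: "finite S" and t: "t > 0" and sum0: "(\<Sum>i\<in>S. of_real t * (s i * cnj (s i))) = 0"
    and i: "i \<in> S"
  shows "s i = 0"
proof -
  have "(\<Sum>i\<in>S. of_real t * (s i * cnj (s i))) = (\<Sum>i\<in>S. of_real (t * (cmod (s i))\<^sup>2))"
    by (intro sum.cong refl) (metis complex_norm_square of_real_mult)
  also have "\<dots> = of_real (\<Sum>i\<in>S. t * (cmod (s i))\<^sup>2)" by simp
  finally have "(\<Sum>i\<in>S. of_real t * (s i * cnj (s i))) = of_real (\<Sum>i\<in>S. t * (cmod (s i))\<^sup>2)" .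
  then have "(\<Sum>i\<in>S. t * (cmod (s i))\<^sup>2) = 0" using sum0 by (metis of_real_eq_0_iff)
  then have "\<forall>j\<in>S. t * (cmod (s j))\<^sup>2 = 0"
    using sum_nonneg_eq_0_iff[OF S, of "\<lambda>j. t * (cmod (s j))\<^sup>2"] t by simp
  then have "t * (cmod (s i))\<^sup>2 = 0" using i by blast
  then show ?thesis using t by simp
qed

lemma sum_weighted_minor_norm_eq_0:
  fixes w :: "'i \<Rightarrow> 'x \<Rightarrow> complex" and t :: real
  assumes M: "\<And>x y. (\<Sum>i\<in>S. of_real t * (w i x * cnj (w i y))) = \<phi> x * cnj (\<phi> y)"
  shows "(\<Sum>i\<in>S. of_real t * ((\<phi> u * w i v - \<phi> v * w i u) * cnj (\<phi> u * w i v - \<phi> v * w i u))) = 0"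
proof -
  have "(\<Sum>i\<in>S. of_real t * ((\<phi> u * w i v - \<phi> v * w i u) * cnj (\<phi> u * w i v - \<phi> v * w i u)))
    = \<phi> u * cnj (\<phi> u) * (\<Sum>i\<in>S. of_real t * (w i v * cnj (w i v)))
      - \<phi> u * cnj (\<phi> v) * (\<Sum>i\<in>S. of_real t * (w i v * cnj (w i u)))
      - \<phi> v * cnj (\<phi> u) * (\<Sum>i\<in>S. of_real t * (w i u * cnj (w i v)))
      + \<phi> v * cnj (\<phi> v) * (\<Sum>i\<in>S. of_real t * (w i u * cnj (w i u)))"
    by (simp add: sum_distrib_left sum_subtractf sum.distrib[symmetric] algebra_simps)
  then show ?thesis unfolding M by (simp add: algebra_simps)
qed

lemma ketbra_sum_eq_ketbraD:
  fixes w :: "'i \<Rightarrow> ('n, 'a) qvec" and t :: real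
  assumes S: "finite S" and t: "t > 0"
    and M: "op_scal (of_real t) (\<Sum>i\<in>S. ketbra (w i)) = ketbra \<phi>"
  shows "\<forall>i\<in>S. \<exists>c. w i = (\<lambda>x. c * \<phi> x)"
    and "\<phi> \<noteq> 0 \<Longrightarrow> \<exists>i\<in>S. w i \<noteq> 0"
proof -
  have M': "(\<Sum>i\<in>S. of_real t * (w i x * cnj (w i y))) = \<phi> x * cnj (\<phi> y)" for x y
    using fun_cong[OF fun_cong[OF M, of x], of y]
    by (simp add: op_scal_def ketbra_def sum_apply2 sum_distrib_left)
  note zero = sum_weighted_norm_eq_0D[OF S t]
  show "\<forall>i\<in>S. \<exists>c. w i = (\<lambda>x. c * \<phi> x)"
  proof (cases "\<phi> = 0")
    case True
    then have "w i x = 0" if "i \<in> S" for i x using zero[OF _ that] M'[of x x] by simp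
    then show ?thesis using True by (intro ballI exI[of _ 0]) auto
  next
    case False
    then obtain x0 where x0: "\<phi> x0 \<noteq> 0" by (auto simp: fun_eq_iff)
    have "\<phi> x0 * w i y - \<phi> y * w i x0 = 0" if "i \<in> S" for i y
      using zero[OF sum_weighted_minor_norm_eq_0[where u=x0 and v=y, OF M'] that] .
    then have "\<forall>i\<in>S. w i = (\<lambda>y. (w i x0 / \<phi> x0) * \<phi> y)"
      using x0 by (auto simp: fun_eq_iff field_simps)
    then show ?thesis by blast
  qed
  assume "\<phi> \<noteq> 0"
  then obtain x0 where x0: "\<phi> x0 \<noteq> 0" by (auto simp: fun_eq_iff)
  show "\<exists>i\<in>S. w i \<noteq> 0"
  proof (rule ccontr)
    assume "\<not> ?thesis"
    then have "\<phi> x0 * cnj (\<phi> x0) = 0" using M'[of x0 x0] by simp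
    then show False using x0 by simp
  qed
qed

text \<open>The recovered state \<open>|\<phi>\<rangle>\<langle>\<phi>|\<close> is pure, so each of its rank-one summands
  \<open>|L\<^sub>k E\<^sub>e \<phi>\<rangle>\<langle>L\<^sub>k E\<^sub>e \<phi>|\<close> is a multiple of it.\<close>
lemma locally_recoverable_errors_scalar:
  fixes Q :: "('n::finite, 'a::{finite,field}) qvec set"
  assumes "locally_recoverable Q I J"
  obtains L :: "nat \<Rightarrow> ('n, 'a) qop" and m
  where "\<And>k. local_on J (L k)"
    and "\<And>\<phi> k a b. \<phi> \<in> Q \<Longrightarrow> k < m \<Longrightarrow> a \<in> supported_on I \<Longrightarrow> b \<in> supported_on I \<Longrightarrow>
           \<exists>c. op_app (L k) (op_app (Eop a b) \<phi>) = (\<lambda>x. c * \<phi> x)"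
    and "\<And>\<phi>. \<phi> \<in> Q \<Longrightarrow> \<phi> \<noteq> 0 \<Longrightarrow> \<exists>k<m. \<exists>a\<in>supported_on I. \<exists>b\<in>supported_on I. \<exists>c.
           c \<noteq> 0 \<and> op_app (L k) (op_app (Eop a b) \<phi>) = (\<lambda>x. c * \<phi> x)"
proof -
  obtain R where "TP_op_on J R" and rec: "\<And>\<phi>. \<phi> \<in> Q \<Longrightarrow> R (Gamma_I I (ketbra \<phi>)) = ketbra \<phi>"
    using assms unfolding locally_recoverable_def by blast
  then obtain m and B :: "nat \<Rightarrow> ('n, 'a) qop" where
    R: "\<And>rho. R rho = (\<lambda>x y. \<Sum>k<m. op_mult (op_mult (local_op J (B k)) rho) (op_adj (local_op J (B k))) x y)"
    unfolding TP_op_on_def by blast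
  let ?L = "\<lambda>k. local_op J (B k)"
  let ?S = "(supported_on I \<times> supported_on I) \<times> {..<m} :: ((('n \<Rightarrow> 'a) \<times> ('n \<Rightarrow> 'a)) \<times> nat) set"
  let ?w = "\<lambda>\<phi> ((a, b), k). op_app (?L k) (op_app (Eop a b) \<phi>)"
  define t :: real where "t = ((1 / real (card (UNIV :: 'a set))) ^ 2) ^ card I"
  have t: "t > 0" unfolding t_def by simp
  have M: "op_scal (of_real t) (\<Sum>i\<in>?S. ketbra (?w \<phi> i)) = ketbra \<phi>" if "\<phi> \<in> Q" for \<phi>
    using kraus_Gamma_I_ketbra[OF R, of I \<phi>] rec[OF that]
    by (simp add: t_def sum.cartesian_product case_prod_beta)
  have fin: "finite ?S" by simp
  note P = ketbra_sum_eq_ketbraD[OF fin t M]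
  show ?thesis
  proof
    show "local_on J (?L k)" for k by (rule local_on_local_op)
  next
    fix \<phi> k and a b :: "'n \<Rightarrow> 'a" assume "\<phi> \<in> Q" "k < m" "a \<in> supported_on I" "b \<in> supported_on I"
    then show "\<exists>c. op_app (?L k) (op_app (Eop a b) \<phi>) = (\<lambda>x. c * \<phi> x)"
      using P(1)[of \<phi>] by fastforce
  next
    fix \<phi> assume \<phi>: "\<phi> \<in> Q" "\<phi> \<noteq> 0"
    obtain a b k where i: "((a, b), k) \<in> ?S" "?w \<phi> ((a, b), k) \<noteq> 0"
      using P(2)[OF \<phi>] by (metis prod.collapse)
    moreover obtain c where "?w \<phi> ((a, b), k) = (\<lambda>x. c * \<phi> x)" using P(1)[OF \<phi>(1)] i(1) by blast
    ultimately show "\<exists>k<m. \<exists>a\<in>supported_on I. \<exists>b\<in>supported_on I. \<exists>c.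
           c \<noteq> 0 \<and> op_app (?L k) (op_app (Eop a b) \<phi>) = (\<lambda>x. c * \<phi> x)"
      by (auto simp: fun_eq_iff)
  qed
qed

lemma TP_op_on_finite_kraus:
  fixes A :: "'k \<Rightarrow> ('n::finite, 'a::{finite,field}) qop"
  assumes fin: "finite K" and loc: "\<And>k. k \<in> K \<Longrightarrow> local_on J (A k)"
    and complete: "(\<Sum>k\<in>K. op_mult (op_adj (A k)) (A k)) = op_id"
  shows "TP_op_on J (\<lambda>rho x y. \<Sum>k\<in>K. op_mult (op_mult (A k) rho) (op_adj (A k)) x y)"
proof -
  let ?n = "card K"
  obtain h where h: "bij_betw h {..<?n} K"
    using ex_bij_betw_nat_finite[OF fin] by (auto simp: atLeast0LessThan)
  define B where "B i = A (h i)" for i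
  have "local_op J (B i) = B i" if "i < ?n" for i
    using loc h that unfolding B_def by (auto intro: local_op_eq_self dest: bij_betwE)
  then have reindex: "(\<Sum>i<?n. f (local_op J (B i))) = (\<Sum>k\<in>K. f (A k))" for f :: "_ \<Rightarrow> complex"
    unfolding B_def using sum.reindex_bij_betw[OF h, of "\<lambda>k. f (A k)"] by simp
  show ?thesis
    unfolding TP_op_on_def
  proof (intro exI conjI allI ext)
    fix x y
    have "(\<Sum>i<?n. op_mult (op_adj (local_op J (B i))) (local_op J (B i)) x y)
        = (\<Sum>k\<in>K. op_mult (op_adj (A k)) (A k) x y)"
      by (rule reindex[of "\<lambda>X. op_mult (op_adj X) X x y"])
    also have "\<dots> = op_id x y" using fun_cong[OF fun_cong[OF complete, of x], of y] by (simp add: sum_apply2)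
    finally show "(\<Sum>i<?n. op_mult (op_adj (local_op J (B i))) (local_op J (B i)) x y) = op_id x y" .
  next
    fix rho x y
    show "(\<Sum>k\<in>K. op_mult (op_mult (A k) rho) (op_adj (A k)) x y)
        = (\<Sum>i<?n. op_mult (op_mult (local_op J (B i)) rho) (op_adj (local_op J (B i))) x y)"
      by (rule reindex[of "\<lambda>X. op_mult (op_mult X rho) (op_adj X) x y", symmetric])
  qed
qed

lemma locally_recoverableI:
  fixes A :: "'k \<Rightarrow> ('n::finite, 'a::{finite,field}) qop" and Q :: "('n, 'a) qvec set"
  assumes fin: "finite K" and loc: "\<And>k. k \<in> K \<Longrightarrow> local_on J (A k)"
    and complete: "(\<Sum>k\<in>K. op_mult (op_adj (A k)) (A k)) = op_id"
    and rec: "\<And>\<phi> a b. \<phi> \<in> Q \<Longrightarrow> a \<in> supported_on I \<Longrightarrow> b \<in> supported_on I \<Longrightarrow>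
                (\<Sum>k\<in>K. ketbra (op_app (A k) (op_app (Eop a b) \<phi>))) = ketbra \<phi>"
  shows "locally_recoverable Q I J"
proof -
  let ?R = "\<lambda>rho x y. \<Sum>k\<in>K. op_mult (op_mult (A k) rho) (op_adj (A k)) x y"
  let ?t = "((1 / of_nat (card (UNIV :: 'a set))) ^ 2) ^ card I :: complex"
  have "?R (Gamma_I I (ketbra \<phi>)) = ketbra \<phi>" if \<phi>: "\<phi> \<in> Q" for \<phi>
  proof -
    have "?R (Gamma_I I (ketbra \<phi>)) = op_scal ?t
          (\<Sum>(a, b)\<in>supported_on I \<times> supported_on I. \<Sum>k\<in>K. ketbra (op_app (A k) (op_app (Eop a b) \<phi>)))"
      by (rule kraus_Gamma_I_ketbra) simp
    also have "\<dots> = op_scal ?t (\<Sum>(a :: 'n \<Rightarrow> 'a, b :: 'n \<Rightarrow> 'a)\<in>supported_on I \<times> supported_on I. ketbra \<phi>)"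
      using rec[OF \<phi>] by (intro arg_cong[where f="op_scal ?t"] sum.cong refl) (auto split: prod.split)
    also have "\<dots> = ketbra \<phi>"
    proof (intro ext)
      fix x y
      show "op_scal ?t (\<Sum>(a :: 'n \<Rightarrow> 'a, b :: 'n \<Rightarrow> 'a)\<in>supported_on I \<times> supported_on I. ketbra \<phi>) x y
          = ketbra \<phi> x y"
        unfolding op_scal_def sum_apply2 using inverse_square_power_mult_of_nat[of "card (UNIV :: 'a set)" "card I"]
        by (simp add: card_errors mult.assoc[symmetric] finite_UNIV_card_ge_0)
    qed
    finally show ?thesis .
  qed
  then show ?thesis
    unfolding locally_recoverable_def using TP_op_on_finite_kraus[OF fin loc complete] by blast
qed


section \<open>The stabilizer code of a product code\<close>

text \<open>\<open>eigval a b\<close> is the eigenvalue of \<open>E\<^sub>(\<^sub>a\<^sub>,\<^sub>b\<^sub>)\<close> on the code.\<close>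
locale css_stabilizer =
  fixes C1 C2 :: "('n::finite \<Rightarrow> 'a::{finite,field}) set"
    and lam :: "('n, 'a) qop \<Rightarrow> complex"
  assumes linear_C1: "linear_code C1" and linear_C2: "linear_code C2"
    and C2_subset: "C2 \<subseteq> edual C1"
    and lam: "stab_char (prod_code C1 C2) lam"
begin

abbreviation "Q \<equiv> stab_code (prod_code C1 C2) lam"

definition eigval :: "('n \<Rightarrow> 'a) \<Rightarrow> ('n \<Rightarrow> 'a) \<Rightarrow> complex" where
  "eigval a b = lam (Eop a b)"

lemma C2_orth: "b \<in> C2 \<Longrightarrow> c \<in> C1 \<Longrightarrow> edot b c = 0"
  using C2_subset by (auto simp: edual_def)

lemma C1_subset: "C1 \<subseteq> edual C2"
  by (rule subset_edual_sym[OF C2_subset])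

lemma lam_mult:
  "A \<in> stab_group (prod_code C1 C2) \<Longrightarrow> B \<in> stab_group (prod_code C1 C2) \<Longrightarrow>
     lam (op_mult A B) = lam A * lam B"
  using lam by (simp add: stab_char_def)

lemma Eop_in_stab_group: "a \<in> C1 \<Longrightarrow> b \<in> C2 \<Longrightarrow> Eop a b \<in> stab_group (prod_code C1 C2)"
  by (rule stab_group.gen) (simp add: prod_code_def)

lemma lam_xi: "lam (op_scal (xi TYPE('a)) op_id) = xi TYPE('a)"
  using lam by (simp add: stab_char_def)

lemma lam_id: "lam op_id = 1"
proof -
  have "lam (op_mult op_id (op_scal (xi TYPE('a)) op_id)) = lam op_id * xi TYPE('a)"
    using lam_mult[OF stab_group.scal[of 0] stab_group.scal[of 1]] lam_xi by simp
  moreover have "xi TYPE('a) \<noteq> 0" using norm_xi_power[where 'a='a, of 1] by auto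
  ultimately show ?thesis using lam_xi by simp
qed

lemma lam_scal_xi_power: "lam (op_scal (xi TYPE('a) ^ l) op_id) = xi TYPE('a) ^ l"
proof (induction l)
  case (Suc l)
  have "op_scal (xi TYPE('a) ^ Suc l) (op_id :: ('n, 'a) qop)
      = op_mult (op_scal (xi TYPE('a)) op_id) (op_scal (xi TYPE('a) ^ l) op_id)"
    by (simp add: op_mult_scal_left op_mult_scal_right op_scal_scal mult.commute)
  then have "lam (op_scal (xi TYPE('a) ^ Suc l) op_id)
      = lam (op_scal (xi TYPE('a)) op_id) * lam (op_scal (xi TYPE('a) ^ l) op_id)"
    using lam_mult[OF stab_group.scal[of 1] stab_group.scal[of l]] by simp
  then show ?case using Suc lam_xi by simp
qed (simp add: lam_id)

lemma Eop_mult_code: "b \<in> C2 \<Longrightarrow> c \<in> C1 \<Longrightarrow> op_mult (Eop a b) (Eop c d) = Eop (a + c) (b + d)"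
  by (simp add: Eop_mult C2_orth)

lemma eigval_add:
  assumes "a \<in> C1" "b \<in> C2" "c \<in> C1" "d \<in> C2"
  shows "eigval (a + c) (b + d) = eigval a b * eigval c d"
  unfolding eigval_def using Eop_mult_code[of b c a d] assms
  by (simp add: lam_mult[OF Eop_in_stab_group Eop_in_stab_group, symmetric])

lemma eigval_0_0: "eigval 0 0 = 1"
  by (simp add: eigval_def Eop_0_0 lam_id)

text \<open>\<open>eigval\<close> is a character of the \<open>p\<close>-torsion group \<open>C\<^sub>1 \<times> C\<^sub>2\<close>, so its values are roots of unity.\<close>
lemma norm_eigval:
  assumes a: "a \<in> C1" and b: "b \<in> C2"
  shows "norm (eigval a b) = 1"
proof -
  have "eigval (smul (of_nat k) a) (smul (of_nat k) b) = eigval a b ^ k" for k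
  proof (induction k)
    case 0 then show ?case using eigval_0_0 by (simp add: smul_def zero_fun_def)
  next
    case (Suc k)
    have "eigval (smul (of_nat (Suc k)) a) (smul (of_nat (Suc k)) b)
        = eigval (a + smul (of_nat k) a) (b + smul (of_nat k) b)"
      by (simp only: smul_of_nat_Suc)
    also have "\<dots> = eigval a b * eigval (smul (of_nat k) a) (smul (of_nat k) b)"
      by (rule eigval_add[OF a b linear_code_smul[OF linear_C1 a] linear_code_smul[OF linear_C2 b]])
    finally show ?case using Suc by simp
  qed
  from this[of "CHAR('a)"] have "eigval a b ^ CHAR('a) = 1" by (simp add: eigval_0_0)
  then have "norm (eigval a b) ^ CHAR('a) = 1" by (metis norm_one norm_power)
  then show ?thesis using power_eq_imp_eq_base[of "norm (eigval a b)" "CHAR('a)" 1] CHAR_pos by simp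
qed

lemma eigval_split: "a \<in> C1 \<Longrightarrow> b \<in> C2 \<Longrightarrow> eigval a b = eigval a 0 * eigval 0 b"
  using eigval_add[of a 0 0 b] linear_code_zero[OF linear_C1] linear_code_zero[OF linear_C2] by simp

lemma eigval_uminus:
  assumes a: "a \<in> C1" and b: "b \<in> C2"
  shows "eigval (- a) (- b) = cnj (eigval a b)"
proof -
  have "eigval a b * eigval (- a) (- b) = 1"
    using eigval_add[OF a b linear_code_uminus[OF linear_C1 a] linear_code_uminus[OF linear_C2 b]]
    by (simp add: eigval_0_0)
  moreover have "cnj (eigval a b) * eigval a b = 1" by (rule cnj_mult_self_norm_1[OF norm_eigval[OF a b]])
  ultimately show ?thesis by (metis mult.assoc mult_1 mult_1_right)
qed

lemma op_app_stab_group: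
  assumes "E \<in> stab_group (prod_code C1 C2)"
    and v: "\<And>a b. a \<in> C1 \<Longrightarrow> b \<in> C2 \<Longrightarrow> op_app (Eop a b) v = (\<lambda>x. eigval a b * v x)"
  shows "op_app E v = (\<lambda>x. lam E * v x)"
  using assms(1)
proof induction
  case (scal l)
  then show ?case by (simp add: lam_scal_xi_power op_app_scal)
next
  case (gen a b)
  then show ?case using v by (simp add: prod_code_def eigval_def)
next
  case (mult A B)
  then show ?case by (simp add: op_app_mult op_app_cmult lam_mult mult_ac)
qed

lemma op_app_Eop_stab_code:
  "v \<in> Q \<Longrightarrow> a \<in> C1 \<Longrightarrow> b \<in> C2 \<Longrightarrow> op_app (Eop a b) v = (\<lambda>x. eigval a b * v x)"
  unfolding stab_code_def eigval_def using Eop_in_stab_group by blast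

lemma mem_stab_code_iff:
  "v \<in> Q \<longleftrightarrow> (\<forall>a\<in>C1. \<forall>b\<in>C2. \<forall>x. psi (edot b (x - a)) * v (x - a) = eigval a b * v x)"
proof
  assume "v \<in> Q"
  then show "\<forall>a\<in>C1. \<forall>b\<in>C2. \<forall>x. psi (edot b (x - a)) * v (x - a) = eigval a b * v x"
    using op_app_Eop_stab_code by (simp add: op_app_Eop fun_eq_iff)
next
  assume "\<forall>a\<in>C1. \<forall>b\<in>C2. \<forall>x. psi (edot b (x - a)) * v (x - a) = eigval a b * v x"
  then have "\<And>a b. a \<in> C1 \<Longrightarrow> b \<in> C2 \<Longrightarrow> op_app (Eop a b) v = (\<lambda>x. eigval a b * v x)"
    by (simp add: op_app_Eop fun_eq_iff)
  then show "v \<in> Q" unfolding stab_code_def using op_app_stab_group by blast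
qed

lemma stab_code_add: "v \<in> Q \<Longrightarrow> w \<in> Q \<Longrightarrow> (\<lambda>x. v x + w x) \<in> Q"
  unfolding mem_stab_code_iff by (simp add: distrib_left)

text \<open>The hypotheses say that \<open>E\<^sub>(\<^sub>u\<^sub>,\<^sub>w\<^sub>)\<close> commutes with the stabilizer.\<close>
lemma op_app_Eop_logical:
  assumes u: "u \<in> edual C2" and w: "w \<in> edual C1" and v: "v \<in> Q"
  shows "op_app (Eop u w) v \<in> Q"
  unfolding mem_stab_code_iff op_app_Eop
proof (intro ballI allI)
  fix a b x assume a: "a \<in> C1" and b: "b \<in> C2"
  have "edot b u = 0" "edot w a = 0" using u w a b by (simp_all add: edual_orth edual_orth')
  then have "edot b (x - u - a) = edot b (x - a)" "edot w (x - u - a) = edot w (x - u)"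
    by (simp_all add: edot_diff_right)
  moreover have swap: "x - a - u = x - u - a" by (simp add: algebra_simps)
  ultimately have "psi (edot b (x - a)) * (psi (edot w (x - a - u)) * v (x - a - u))
      = psi (edot w (x - u)) * (psi (edot b (x - u - a)) * v (x - u - a))"
    unfolding swap by (simp add: mult_ac)
  also have "\<dots> = eigval a b * (psi (edot w (x - u)) * v (x - u))"
    using v a b by (simp add: mem_stab_code_iff)
  finally show "psi (edot b (x - a)) * (psi (edot w (x - a - u)) * v (x - a - u))
      = eigval a b * (psi (edot w (x - u)) * v (x - u))" .
qed

text \<open>A coset state is supported on the coset \<open>x\<^sub>0 + C\<^sub>1\<close>; it lies in the code when the
  \<open>Z\<close>-type stabilizers have the prescribed eigenvalues at \<open>x\<^sub>0\<close>.\<close>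
definition coset_state :: "('n \<Rightarrow> 'a) \<Rightarrow> ('n, 'a) qvec" where
  "coset_state x0 = (\<lambda>x. if x - x0 \<in> C1 then cnj (eigval (x - x0) 0) else 0)"

definition coset_base :: "('n \<Rightarrow> 'a) \<Rightarrow> bool" where
  "coset_base x0 \<longleftrightarrow> (\<forall>b\<in>C2. psi (edot b x0) = eigval 0 b)"

lemma coset_state_self: "coset_state x0 x0 = 1"
  unfolding coset_state_def using linear_code_zero[OF linear_C1] eigval_0_0 by simp

lemma coset_state_nonzero_iff: "coset_state x0 x \<noteq> 0 \<longleftrightarrow> x - x0 \<in> C1"
proof (cases "x - x0 \<in> C1")
  case True
  then have "norm (eigval (x - x0) 0) = 1" using norm_eigval linear_code_zero[OF linear_C2] by blast
  then show ?thesis using True unfolding coset_state_def by auto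
qed (simp add: coset_state_def)

lemma coset_state_in_stab_code:
  assumes x0: "coset_base x0"
  shows "coset_state x0 \<in> Q"
  unfolding mem_stab_code_iff
proof (intro ballI allI)
  fix a b x assume a: "a \<in> C1" and b: "b \<in> C2"
  show "psi (edot b (x - a)) * coset_state x0 (x - a) = eigval a b * coset_state x0 x"
  proof (cases "x - x0 \<in> C1")
    case True
    let ?c = "x - a - x0"
    have c: "?c \<in> C1" using linear_code_diff[OF linear_C1 True a] by (simp add: algebra_simps)
    have "eigval (x - x0) 0 = eigval ?c 0 * eigval a 0"
      using eigval_add[OF c linear_code_zero[OF linear_C2] a linear_code_zero[OF linear_C2]]
      by (simp add: algebra_simps)
    then have "cnj (eigval ?c 0) = cnj (eigval (x - x0) 0) * eigval a 0"
      using cnj_mult_self_norm_1[OF norm_eigval[OF a linear_code_zero[OF linear_C2]]] by (simp add: mult.assoc)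
    moreover have "psi (edot b (x - a)) = eigval 0 b"
    proof -
      have "edot b (x - a) = edot b (x0 + ?c)" by (simp add: algebra_simps)
      also have "\<dots> = edot b x0" using C2_orth[OF b c] by (simp only: edot_add_right) simp
      finally show ?thesis using x0 b unfolding coset_base_def by simp
    qed
    ultimately show ?thesis
      unfolding coset_state_def using c True eigval_split[OF a b] by (simp add: mult_ac)
  next
    case False
    have "x - a - x0 \<notin> C1"
    proof
      assume "x - a - x0 \<in> C1"
      then have "x - a - x0 + a \<in> C1" using linear_code_add[OF linear_C1 _ a] by blast
      then show False using False by (simp add: algebra_simps)
    qed
    then show ?thesis unfolding coset_state_def using False by simp
  qed
qed

lemma coset_base_add_edual: "coset_base x0 \<Longrightarrow> d \<in> edual C2 \<Longrightarrow> coset_base (x0 + d)"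
  unfolding coset_base_def by (simp add: edot_add_right psi_add edual_orth')

text \<open>Summing the character \<open>b \<mapsto> cnj (eigval 0 b) * \<psi>(b\<cdot>x)\<close> of \<open>C\<^sub>2\<close> over all \<open>x\<close> gives
  \<open>q\<^sup>n \<noteq> 0\<close>, so it is trivial for some \<open>x\<close>.\<close>
lemma ex_coset_base: "\<exists>x0. coset_base x0"
proof -
  let ?chi = "\<lambda>x b. cnj (eigval 0 b) * psi (edot b x)"
  let ?N = "of_nat (card (UNIV :: ('n \<Rightarrow> 'a) set)) :: complex"
  have inner: "(\<Sum>x\<in>UNIV. psi (edot b x)) = (if b = 0 then ?N else 0)" for b :: "'n \<Rightarrow> 'a"
    using sum_psi_edot[OF linear_code_supported_on[of UNIV], of b]
      supported_on_edual_eq_0[of b UNIV] by (auto simp: edual_def edot_comm)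
  have "(\<Sum>x\<in>UNIV. \<Sum>b\<in>C2. ?chi x b) = (\<Sum>b\<in>C2. cnj (eigval 0 b) * (\<Sum>x\<in>UNIV. psi (edot b x)))"
    by (subst sum.swap) (simp add: sum_distrib_left)
  also have "\<dots> = (\<Sum>b\<in>C2. if b = 0 then cnj (eigval 0 b) * ?N else 0)"
    by (intro sum.cong refl) (simp add: inner)
  also have "\<dots> = ?N" using linear_code_zero[OF linear_C2] by (simp add: sum.delta eigval_0_0)
  finally have "(\<Sum>x\<in>UNIV. \<Sum>b\<in>C2. ?chi x b) \<noteq> 0" by simp
  then obtain x0 where x0: "(\<Sum>b\<in>C2. ?chi x0 b) \<noteq> 0" by (meson sum.neutral)
  have chi: "?chi x0 b = 1" if b: "b \<in> C2" for b
  proof (rule ccontr)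
    assume "?chi x0 b \<noteq> 1"
    moreover have "?chi x0 (g + h) = ?chi x0 g * ?chi x0 h" if "g \<in> C2" "h \<in> C2" for g h
      using eigval_add[OF linear_code_zero[OF linear_C1] that(1) linear_code_zero[OF linear_C1] that(2)]
      by (simp add: edot_add_left psi_add)
    ultimately have "(\<Sum>b\<in>C2. ?chi x0 b) = 0"
      using b by (intro sum_hom_eq_0) (auto intro: linear_code_add[OF linear_C2] linear_code_diff[OF linear_C2])
    with x0 show False by contradiction
  qed
  have unit: "eigval 0 b * cnj (eigval 0 b) = 1" if "b \<in> C2" for b
    using cnj_mult_self_norm_1[OF norm_eigval[OF linear_code_zero[OF linear_C1] that]] by (simp add: mult.commute)
  have "psi (edot b x0) = eigval 0 b" if "b \<in> C2" for b
  proof -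
    have "psi (edot b x0) = (eigval 0 b * cnj (eigval 0 b)) * psi (edot b x0)"
      using \<open>b \<in> C2\<close> unit by simp
    then show ?thesis using \<open>b \<in> C2\<close> chi by (simp add: mult.assoc)
  qed
  then show ?thesis unfolding coset_base_def by blast
qed

end


section \<open>Necessity of the shortening conditions\<close>

lemma Eop_mult_disjoint:
  assumes "w' \<in> supported_on A" "u \<in> supported_on B" "A \<inter> B = {}"
  shows "op_app (Eop (u + u') (w + w')) v = op_app (Eop u' w') (op_app (Eop u w) v)"
  using edot_supported_on_disjoint[OF assms]
  by (simp add: op_app_mult[symmetric] Eop_mult add.commute)

lemma op_app_Eop_restr_split:
  "op_app (Eop u w) v = op_app (Eop (u - restr J u) (w - restr J w)) (op_app (Eop (restr J u) (restr J w)) v)"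
  using Eop_mult_disjoint[where w' = "w - restr J w" and A = "- J" and u = "restr J u" and B = J
      and u' = "u - restr J u" and w = "restr J w"]
  by (simp add: diff_restr_supported_on_Compl restr_supported_on)

lemma op_app_Eop_restr_error:
  assumes a: "a \<in> supported_on J"
  shows "op_app (Eop (a - restr J u) (b - restr J w)) (op_app (Eop u w) v)
       = (\<lambda>x. psi (edot (b - restr J w) u) *
              op_app (Eop (u - restr J u) (w - restr J w)) (op_app (Eop a b) v) x)"
proof -
  have e: "a - restr J u + u = a + (u - restr J u)" "b - restr J w + w = b + (w - restr J w)" by simp_all
  have "op_app (Eop (a - restr J u) (b - restr J w)) (op_app (Eop u w) v)
      = (\<lambda>x. psi (edot (b - restr J w) u) * op_app (Eop (a - restr J u + u) (b - restr J w + w)) v x)"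
    by (simp add: op_app_mult[symmetric] Eop_mult op_app_scal)
  also have "\<dots> = (\<lambda>x. psi (edot (b - restr J w) u) * op_app (Eop (a + (u - restr J u)) (b + (w - restr J w))) v x)"
    unfolding e ..
  also have "op_app (Eop (a + (u - restr J u)) (b + (w - restr J w))) v
      = op_app (Eop (u - restr J u) (w - restr J w)) (op_app (Eop a b) v)"
    using Eop_mult_disjoint[where w' = "w - restr J w" and A = "- J" and u = a and B = J
        and u' = "u - restr J u" and w = b] a
    by (simp add: diff_restr_supported_on_Compl)
  finally show ?thesis .
qed

lemma op_app_Eop_cancel_multiple:
  assumes "op_app (Eop u w) (\<lambda>x. c * f x) = op_app (Eop u w) (\<lambda>x. d * \<phi> x)" and "d \<noteq> 0" and "\<phi> \<noteq> 0"
  shows "\<exists>c. f = (\<lambda>x. c * \<phi> x)"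
proof -
  have eq: "(\<lambda>x. c * f x) = (\<lambda>x. d * \<phi> x)" using assms(1) by (metis op_app_adj_Eop)
  then have "c \<noteq> 0" using assms(2,3) by (auto simp: fun_eq_iff)
  then have "f = (\<lambda>x. (d / c) * \<phi> x)" using eq by (auto simp: fun_eq_iff field_simps)
  then show ?thesis by blast
qed

context css_stabilizer
begin

text \<open>Let \<open>E\<^sub>(\<^sub>u\<^sub>,\<^sub>w\<^sub>)\<close> be a logical operator whose restriction to
  \<open>J\<close> is supported on \<open>I\<close>. Split it as \<open>E\<^sub>K E\<^sub>I\<close> with \<open>E\<^sub>K\<close> supported outside \<open>J\<close>. If a recovery
  Kraus operator \<open>L\<close> maps \<open>E\<^sub>e \<phi>\<close> to \<open>c \<phi>\<close> with \<open>c \<noteq> 0\<close>, it must map \<open>E\<^sub>e E\<^sub>I\<^sup>-\<^sup>1 (E\<^sub>(\<^sub>u\<^sub>,\<^sub>w\<^sub>) \<phi>)\<close>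
  to a multiple of \<open>E\<^sub>(\<^sub>u\<^sub>,\<^sub>w\<^sub>) \<phi>\<close>; since \<open>L\<close> commutes with \<open>E\<^sub>K\<close>, it also maps it to a multiple of
  \<open>E\<^sub>K \<phi>\<close>. Hence \<open>E\<^sub>I \<phi>\<close> is a multiple of \<open>\<phi>\<close>.\<close>
lemma logical_restr_acts_as_scalar:
  assumes rec: "locally_recoverable Q I J" and IJ: "I \<subseteq> J"
    and u: "u \<in> edual C2" and w: "w \<in> edual C1"
    and uI: "restr J u \<in> supported_on I" and wI: "restr J w \<in> supported_on I"
    and \<phi>: "\<phi> \<in> Q" "\<phi> \<noteq> 0"
  shows "\<exists>c. op_app (Eop (restr J u) (restr J w)) \<phi> = (\<lambda>x. c * \<phi> x)"
proof (rule locally_recoverable_errors_scalar[OF rec])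
  fix L :: "nat \<Rightarrow> ('n, 'a) qop" and m
  assume loc: "\<And>k. local_on J (L k)"
    and scalar: "\<And>\<phi> k a b. \<phi> \<in> Q \<Longrightarrow> k < m \<Longrightarrow> a \<in> supported_on I \<Longrightarrow> b \<in> supported_on I \<Longrightarrow>
           \<exists>c. op_app (L k) (op_app (Eop a b) \<phi>) = (\<lambda>x. c * \<phi> x)"
    and nonzero: "\<And>\<phi>. \<phi> \<in> Q \<Longrightarrow> \<phi> \<noteq> 0 \<Longrightarrow> \<exists>k<m. \<exists>a\<in>supported_on I. \<exists>b\<in>supported_on I. \<exists>c.
           c \<noteq> 0 \<and> op_app (L k) (op_app (Eop a b) \<phi>) = (\<lambda>x. c * \<phi> x)"
  let ?EK = "op_app (Eop (u - restr J u) (w - restr J w))"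
  have K: "u - restr J u \<in> supported_on (- J)" "w - restr J w \<in> supported_on (- J)"
    by (simp_all add: diff_restr_supported_on_Compl)
  obtain k a b c where k: "k < m" and a: "a \<in> supported_on I" and b: "b \<in> supported_on I"
    and c: "c \<noteq> 0" and Lk: "op_app (L k) (op_app (Eop a b) \<phi>) = (\<lambda>x. c * \<phi> x)"
    using nonzero[OF \<phi>] by blast
  have "a - restr J u \<in> supported_on I" "b - restr J w \<in> supported_on I"
    using a b uI wI linear_code_diff[OF linear_code_supported_on] by blast+
  then obtain c' where c': "op_app (L k) (op_app (Eop (a - restr J u) (b - restr J w)) (op_app (Eop u w) \<phi>))
      = (\<lambda>x. c' * op_app (Eop u w) \<phi> x)"
    using scalar[OF op_app_Eop_logical[OF u w \<phi>(1)] k] by blast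
  let ?s = "psi (edot (b - restr J w) u)"
  have aJ: "a \<in> supported_on J" using a supported_on_mono[OF IJ] by blast
  have "op_app (L k) (op_app (Eop (a - restr J u) (b - restr J w)) (op_app (Eop u w) \<phi>))
      = (\<lambda>x. ?s * c * ?EK \<phi> x)"
    unfolding op_app_Eop_restr_error[OF aJ] op_app_cmult op_app_local_on_Eop[OF loc K] Lk
    by (simp add: op_app_cmult mult.assoc)
  then have "?EK (\<lambda>x. c' * op_app (Eop (restr J u) (restr J w)) \<phi> x) = ?EK (\<lambda>x. ?s * c * \<phi> x)"
    using c' op_app_Eop_restr_split[of u w _ J] by (simp add: op_app_cmult)
  then show "\<exists>c. op_app (Eop (restr J u) (restr J w)) \<phi> = (\<lambda>x. c * \<phi> x)"
    by (rule op_app_Eop_cancel_multiple) (use c \<phi>(2) in simp_all)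
qed

text \<open>Either a single coset state works, or the sum of the two (whose supports are disjoint).\<close>
lemma ex_stab_code_nonzero_at:
  assumes x0: "coset_base x0" and x1: "coset_base x1"
  shows "\<exists>\<phi>\<in>Q. \<phi> x0 \<noteq> 0 \<and> \<phi> x1 \<noteq> 0"
proof (cases "x0 - x1 \<in> C1")
  case True
  then show ?thesis
    using coset_state_in_stab_code[OF x1] coset_state_nonzero_iff[of x1] coset_state_self[of x1]
    by (intro bexI[of _ "coset_state x1"]) auto
next
  case False
  then have "x1 - x0 \<notin> C1" using linear_code_uminus[OF linear_C1, of "x1 - x0"] by auto
  then have "coset_state x0 x0 + coset_state x1 x0 \<noteq> 0" "coset_state x0 x1 + coset_state x1 x1 \<noteq> 0"
    using False coset_state_nonzero_iff[of x1 x0] coset_state_nonzero_iff[of x0 x1] coset_state_self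
    by auto
  then show ?thesis
    using stab_code_add[OF coset_state_in_stab_code[OF x0] coset_state_in_stab_code[OF x1]]
    by (intro bexI[of _ "\<lambda>x. coset_state x0 x + coset_state x1 x"]) auto
qed

lemma restr_edual_C1_in_C2:
  assumes rec: "locally_recoverable Q I J" and IJ: "I \<subseteq> J"
    and z: "z \<in> edual C1" and zI: "restr J z \<in> supported_on I"
  shows "restr J z \<in> C2"
proof -
  have "psi (edot (restr J z) d) = 1" if d: "d \<in> edual C2" for d
  proof -
    obtain x0 where x0: "coset_base x0" using ex_coset_base by blast
    obtain \<phi> where \<phi>: "\<phi> \<in> Q" "\<phi> x0 \<noteq> 0" "\<phi> (x0 + d) \<noteq> 0"
      using ex_stab_code_nonzero_at[OF x0 coset_base_add_edual[OF x0 d]] by blast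
    then have "\<phi> \<noteq> 0" by auto
    then obtain c where "op_app (Eop 0 (restr J z)) \<phi> = (\<lambda>x. c * \<phi> x)"
      using logical_restr_acts_as_scalar[OF rec IJ linear_code_zero[OF linear_code_edual] z _ zI \<phi>(1)]
      by (auto simp: zero_supported_on)
    then have "psi (edot (restr J z) x) = c" if "\<phi> x \<noteq> 0" for x
      using that fun_cong[of _ _ x] by (fastforce simp: op_app_Eop)
    then have "psi (edot (restr J z) x0) = c" "psi (edot (restr J z) (x0 + d)) = c"
      using \<phi>(2,3) by blast+
    then show ?thesis using psi_nonzero by (metis edot_add_right psi_add mult_cancel_left1)
  qed
  then have "restr J z \<in> edual (edual C2)"
    by (intro edual_psi_trivial[OF linear_code_edual]) (simp add: edot_comm)
  then show ?thesis using edual_edual[OF linear_C2] by simp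
qed

lemma restr_edual_C2_in_C1:
  assumes rec: "locally_recoverable Q I J" and IJ: "I \<subseteq> J"
    and z: "z \<in> edual C2" and zI: "restr J z \<in> supported_on I"
  shows "restr J z \<in> C1"
proof -
  obtain x0 where x0: "coset_base x0" using ex_coset_base by blast
  let ?\<phi> = "coset_state x0"
  have "?\<phi> \<noteq> 0" using coset_state_self[of x0] by auto
  then obtain c where "op_app (Eop (restr J z) 0) ?\<phi> = (\<lambda>x. c * ?\<phi> x)"
    using logical_restr_acts_as_scalar[OF rec IJ z linear_code_zero[OF linear_code_edual] zI _
        coset_state_in_stab_code[OF x0]]
    by (auto simp: zero_supported_on)
  then have "c * ?\<phi> (x0 + restr J z) = ?\<phi> x0"
    using fun_cong[of _ _ "x0 + restr J z"] by (fastforce simp: op_app_Eop)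
  then have "?\<phi> (x0 + restr J z) \<noteq> 0" using coset_state_self[of x0] by auto
  then show ?thesis using coset_state_nonzero_iff by simp
qed

end


section \<open>Sufficiency: syndrome measurement on the qudits in J\<close>

lemma sum_insert_None_image_Some:
  "finite S \<Longrightarrow> (\<Sum>k\<in>insert None (Some ` S). f k) = f None + (\<Sum>s\<in>S. f (Some s))"
  by (simp add: sum.reindex)

context css_stabilizer
begin

text \<open>The stabilizers supported on \<open>J\<close>, rescaled to act trivially on the code, form a unitary
  representation; measuring its characters is the syndrome measurement on \<open>J\<close>.\<close>
definition local_stab :: "'n set \<Rightarrow> (('n \<Rightarrow> 'a) \<times> ('n \<Rightarrow> 'a)) set" where
  "local_stab J = (C1 \<inter> supported_on J) \<times> (C2 \<inter> supported_on J)"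

definition stab_unitary :: "('n \<Rightarrow> 'a) \<times> ('n \<Rightarrow> 'a) \<Rightarrow> ('n, 'a) qop" where
  "stab_unitary y = op_scal (cnj (eigval (fst y) (snd y))) (Eop (fst y) (snd y))"

lemma unitary_rep_local_stab: "unitary_rep (local_stab J) stab_unitary"
proof
  show "finite (local_stab J)" by (rule finite_subset[of _ UNIV]) auto
  show "0 \<in> local_stab J"
    using linear_code_zero[OF linear_C1] linear_code_zero[OF linear_C2] by (simp add: local_stab_def zero_prod_def)
next
  fix g h assume "g \<in> local_stab J" "h \<in> local_stab J"
  then show "g + h \<in> local_stab J"
    by (cases g, cases h)
       (auto simp: local_stab_def intro: linear_code_add[OF linear_C1] linear_code_add[OF linear_C2]
         linear_code_add[OF linear_code_supported_on])
next
  fix g assume "g \<in> local_stab J"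
  then show "- g \<in> local_stab J"
    by (cases g)
       (auto simp: local_stab_def intro: linear_code_uminus[OF linear_C1] linear_code_uminus[OF linear_C2]
         linear_code_uminus[OF linear_code_supported_on])
next
  fix g h assume "g \<in> local_stab J" "h \<in> local_stab J"
  then show "op_mult (stab_unitary g) (stab_unitary h) = stab_unitary (g + h)"
    by (cases g, cases h)
       (simp add: local_stab_def stab_unitary_def op_mult_scal_left op_mult_scal_right op_scal_scal
         Eop_mult_code eigval_add mult.commute)
next
  fix g assume "g \<in> local_stab J"
  then obtain a b where g: "g = (a, b)" and a: "a \<in> C1" and b: "b \<in> C2"
    by (auto simp: local_stab_def)
  have "edot a b = 0" using C2_orth[OF b a] by (simp add: edot_comm)
  then show "op_adj (stab_unitary g) = stab_unitary (- g)"
    by (simp add: g stab_unitary_def op_adj_scal op_adj_Eop op_scal_scal eigval_uminus[OF a b])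
qed

abbreviation syndrome_proj :: "'n set \<Rightarrow> ((('n \<Rightarrow> 'a) \<times> ('n \<Rightarrow> 'a)) \<Rightarrow> complex) \<Rightarrow> ('n, 'a) qop" where
  "syndrome_proj J \<equiv> unitary_rep.char_proj (local_stab J) stab_unitary"

text \<open>The syndrome of an error \<open>e\<close> is the character \<open>y \<mapsto> \<psi>(\<langle>y, e\<rangle>\<^sub>s)\<close> of \<open>local_stab J\<close>; it is set
  to \<open>0\<close> outside \<open>local_stab J\<close> so that syndromes agreeing on the group are equal.\<close>
definition syndrome :: "'n set \<Rightarrow> ('n \<Rightarrow> 'a) \<times> ('n \<Rightarrow> 'a) \<Rightarrow> ('n \<Rightarrow> 'a) \<times> ('n \<Rightarrow> 'a) \<Rightarrow> complex" where
  "syndrome J e = (\<lambda>y. if y \<in> local_stab J then psi (edot (snd y) (fst e) - edot (snd e) (fst y)) else 0)"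

lemma is_char_syndrome: "unitary_rep.is_char (local_stab J) (syndrome J e)"
  unfolding unitary_rep.is_char_def[OF unitary_rep_local_stab]
proof (intro conjI ballI)
  fix g h assume "g \<in> local_stab J" "h \<in> local_stab J"
  moreover have "g + h \<in> local_stab J" by (rule unitary_rep.add_in_G[OF unitary_rep_local_stab]) fact+
  ultimately show "syndrome J e (g + h) = syndrome J e g * syndrome J e h"
    by (simp add: syndrome_def edot_add_left edot_add_right psi_add[symmetric] algebra_simps)
qed (simp add: syndrome_def)

lemma syndrome_eq_iff:
  "syndrome J e = syndrome J e' \<longleftrightarrow> (\<forall>y\<in>local_stab J. syndrome J e y = syndrome J e' y)"
  by (auto simp: syndrome_def fun_eq_iff)

lemma stab_unitary_error:
  assumes \<phi>: "\<phi> \<in> Q" and y: "y \<in> local_stab J"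
  shows "op_app (stab_unitary y) (op_app (Eop a b) \<phi>) = (\<lambda>x. syndrome J (a, b) y * op_app (Eop a b) \<phi> x)"
proof -
  obtain c d where y_cd: "y = (c, d)" and c: "c \<in> C1" and d: "d \<in> C2"
    using y by (cases y) (auto simp: local_stab_def)
  have "op_app (Eop c d) (op_app (Eop a b) \<phi>) = (\<lambda>x. psi (edot d a) * op_app (Eop (a + c) (b + d)) \<phi> x)"
    by (simp add: op_app_mult[symmetric] Eop_mult op_app_scal add.commute)
  moreover have "op_app (Eop (a + c) (b + d)) \<phi> = (\<lambda>x. cnj (psi (edot b c)) * eigval c d * op_app (Eop a b) \<phi> x)"
  proof -
    have "op_app (Eop a b) (op_app (Eop c d) \<phi>) = (\<lambda>x. psi (edot b c) * op_app (Eop (a + c) (b + d)) \<phi> x)"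
      by (simp add: op_app_mult[symmetric] Eop_mult op_app_scal)
    moreover have "op_app (Eop a b) (op_app (Eop c d) \<phi>) = (\<lambda>x. eigval c d * op_app (Eop a b) \<phi> x)"
      by (simp add: op_app_Eop_stab_code[OF \<phi> c d] op_app_cmult)
    ultimately have "(\<lambda>x. psi (edot b c) * op_app (Eop (a + c) (b + d)) \<phi> x)
        = (\<lambda>x. eigval c d * op_app (Eop a b) \<phi> x)" by simp
    then show ?thesis
      using cnj_mult_self_norm_1[OF norm_psi[of "edot b c"]] by (simp add: fun_eq_iff) (metis mult.assoc mult_1)
  qed
  ultimately show ?thesis
    using y cnj_mult_self_norm_1[OF norm_eigval[OF c d]]
    by (simp add: stab_unitary_def y_cd op_app_scal syndrome_def psi_diff fun_eq_iff mult_ac)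
qed

lemma syndrome_proj_error:
  assumes \<phi>: "\<phi> \<in> Q"
  shows "op_app (syndrome_proj J (syndrome J e)) (op_app (Eop a b) \<phi>)
       = (if syndrome J e = syndrome J (a, b) then op_app (Eop a b) \<phi> else (\<lambda>x. 0))"
  using unitary_rep.char_proj_app[OF unitary_rep_local_stab is_char_syndrome is_char_syndrome
      stab_unitary_error[OF \<phi>]]
  by (simp add: syndrome_eq_iff eq_commute)

lemma psi_eq_imp_psi_diff_eq_1: "psi u = psi v \<Longrightarrow> psi (u - v) = 1"
  using cnj_mult_self_norm_1[OF norm_psi[of v]] by (simp add: psi_diff mult.commute)

text \<open>This is where the shortening conditions enter, via \<open>(C \<inter> V\<^sub>J)\<^sup>\<perp> \<inter> V\<^sub>J = \<pi>\<^sub>J(C\<^sup>\<perp>)\<close> for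
  \<open>V\<^sub>J = supported_on J\<close>.\<close>
lemma syndrome_eq_imp_diff_in_code:
  assumes IJ: "I \<subseteq> J"
    and H1: "\<forall>z\<in>edual C1. restr J z \<in> supported_on I \<longrightarrow> restr J z \<in> C2"
    and H2: "\<forall>z\<in>edual C2. restr J z \<in> supported_on I \<longrightarrow> restr J z \<in> C1"
    and e: "a \<in> supported_on I" "b \<in> supported_on I"
    and r: "a' \<in> supported_on I" "b' \<in> supported_on I"
    and eq: "syndrome J (a, b) = syndrome J (a', b')"
  shows "a - a' \<in> C1" and "b - b' \<in> C2"
proof -
  have I: "a - a' \<in> supported_on I" "b - b' \<in> supported_on I"
    using e r linear_code_diff[OF linear_code_supported_on] by blast+
  moreover have "supported_on I \<subseteq> (supported_on J :: ('n \<Rightarrow> 'a) set)" by (rule supported_on_mono[OF IJ])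
  ultimately have J: "a - a' \<in> supported_on J" "b - b' \<in> supported_on J" by auto
  have "psi (edot (b - b') c) = 1" if "c \<in> C1 \<inter> supported_on J" for c
  proof -
    have "(c, 0) \<in> local_stab J" using that linear_code_zero[OF linear_C2] by (simp add: local_stab_def)
    then have "psi (- edot b c) = psi (- edot b' c)" using fun_cong[OF eq, of "(c, 0)"] by (simp add: syndrome_def)
    then show ?thesis using psi_eq_imp_psi_diff_eq_1 by (simp add: psi_uminus edot_diff_left)
  qed
  then have "b - b' \<in> restr J ` edual C1"
    using J(2) edual_psi_trivial[OF linear_code_Int[OF linear_C1 linear_code_supported_on]]
    by (simp add: edual_shorten_supported_on[OF linear_C1, symmetric])
  then obtain z where "z \<in> edual C1" "b - b' = restr J z" by blast
  then show "b - b' \<in> C2" using H1 I(2) by auto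
  have "psi (edot (a - a') d) = 1" if "d \<in> C2 \<inter> supported_on J" for d
  proof -
    have "(0, d) \<in> local_stab J" using that linear_code_zero[OF linear_C1] by (simp add: local_stab_def)
    then have "psi (edot a d) = psi (edot a' d)" using fun_cong[OF eq, of "(0, d)"] by (simp add: syndrome_def edot_comm)
    then show ?thesis using psi_eq_imp_psi_diff_eq_1 by (simp add: edot_diff_left)
  qed
  then have "a - a' \<in> restr J ` edual C2"
    using J(1) edual_psi_trivial[OF linear_code_Int[OF linear_C2 linear_code_supported_on]]
    by (simp add: edual_shorten_supported_on[OF linear_C2, symmetric])
  then obtain z where "z \<in> edual C2" "a - a' = restr J z" by blast
  then show "a - a' \<in> C1" using H2 I(1) by auto
qed

lemma op_app_adj_Eop_Eop_stab_code:
  assumes \<phi>: "\<phi> \<in> Q" and a: "a - a' \<in> C1" and b: "b - b' \<in> C2"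
  shows "\<exists>c. norm c = 1 \<and> op_app (op_adj (Eop a' b')) (op_app (Eop a b) \<phi>) = (\<lambda>x. c * \<phi> x)"
proof -
  let ?c = "psi (edot a' b') * psi (edot (- b') a) * eigval (a - a') (b - b')"
  have "op_mult (op_adj (Eop a' b')) (Eop a b)
      = op_scal (psi (edot a' b') * psi (edot (- b') a)) (Eop (a - a') (b - b'))"
    by (simp add: op_adj_Eop op_mult_scal_left Eop_mult op_scal_scal algebra_simps)
  then have "op_app (op_adj (Eop a' b')) (op_app (Eop a b) \<phi>) = (\<lambda>x. ?c * \<phi> x)"
    by (simp add: op_app_mult[symmetric] op_app_scal op_app_Eop_stab_code[OF \<phi> a b] mult.assoc)
  moreover have "norm ?c = 1" by (simp add: norm_mult norm_eigval[OF a b])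
  ultimately show ?thesis by blast
qed



definition syndromes :: "'n set \<Rightarrow> 'n set \<Rightarrow> ((('n \<Rightarrow> 'a) \<times> ('n \<Rightarrow> 'a)) \<Rightarrow> complex) set" where
  "syndromes I J = syndrome J ` (supported_on I \<times> supported_on I)"

definition syndrome_rep :: "'n set \<Rightarrow> 'n set \<Rightarrow> ((('n \<Rightarrow> 'a) \<times> ('n \<Rightarrow> 'a)) \<Rightarrow> complex) \<Rightarrow> ('n \<Rightarrow> 'a) \<times> ('n \<Rightarrow> 'a)"
  where "syndrome_rep I J s = (SOME e. e \<in> supported_on I \<times> supported_on I \<and> syndrome J e = s)"

text \<open>Measure the syndrome \<open>s\<close> and undo a fixed error \<open>syndrome_rep I J s\<close> producing it; the
  operator indexed by \<open>None\<close> completes the family to a trace-preserving operation.\<close>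
definition recovery_kraus :: "'n set \<Rightarrow> 'n set \<Rightarrow> ((('n \<Rightarrow> 'a) \<times> ('n \<Rightarrow> 'a)) \<Rightarrow> complex) option \<Rightarrow> ('n, 'a) qop"
  where "recovery_kraus I J k = (case k of
      None \<Rightarrow> op_id - (\<Sum>s\<in>syndromes I J. syndrome_proj J s)
    | Some s \<Rightarrow> op_mult (op_adj (case_prod Eop (syndrome_rep I J s))) (syndrome_proj J s))"

lemma finite_syndromes: "finite (syndromes I J)"
  unfolding syndromes_def by simp

lemma syndrome_rep:
  assumes "s \<in> syndromes I J"
  shows "syndrome_rep I J s \<in> supported_on I \<times> supported_on I" and "syndrome J (syndrome_rep I J s) = s"
proof -
  have "\<exists>e. e \<in> supported_on I \<times> supported_on I \<and> syndrome J e = s"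
    using assms unfolding syndromes_def by blast
  then have "syndrome_rep I J s \<in> supported_on I \<times> supported_on I \<and> syndrome J (syndrome_rep I J s) = s"
    unfolding syndrome_rep_def by (rule someI_ex)
  then show "syndrome_rep I J s \<in> supported_on I \<times> supported_on I" "syndrome J (syndrome_rep I J s) = s"
    by auto
qed

lemma local_on_syndrome_proj: "local_on J (syndrome_proj J s)"
  unfolding unitary_rep.char_proj_def[OF unitary_rep_local_stab] stab_unitary_def
  by (auto simp: local_stab_def intro!: local_on_scal local_on_sum local_on_Eop)

lemma local_on_recovery_kraus:
  assumes IJ: "I \<subseteq> J" and k: "k \<in> insert None (Some ` syndromes I J)"
  shows "local_on J (recovery_kraus I J k)"
proof (cases k)
  case None
  then show ?thesis
    by (simp add: recovery_kraus_def local_on_diff local_on_id local_on_sum local_on_syndrome_proj)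
next
  case (Some s)
  obtain a b where r: "syndrome_rep I J s = (a, b)" by fastforce
  then have "a \<in> supported_on I" "b \<in> supported_on I" using k syndrome_rep(1)[of s I J] Some by auto
  then have "a \<in> supported_on J" "b \<in> supported_on J"
    using subsetD[OF supported_on_mono[OF IJ]] by blast+
  then show ?thesis using Some r
    by (auto simp: recovery_kraus_def intro!: local_on_mult local_on_adj local_on_Eop local_on_syndrome_proj)
qed

lemma recovery_kraus_complete:
  "(\<Sum>k\<in>insert None (Some ` syndromes I J). op_mult (op_adj (recovery_kraus I J k)) (recovery_kraus I J k))
     = op_id"
proof -
  have "(\<Sum>s\<in>syndromes I J. op_mult (op_adj (recovery_kraus I J (Some s))) (recovery_kraus I J (Some s)))
      + op_mult (op_adj (recovery_kraus I J None)) (recovery_kraus I J None) = op_id"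
    unfolding recovery_kraus_def option.case
  proof (rule unitary_rep.kraus_completeness[OF unitary_rep_local_stab finite_syndromes])
    fix s assume "s \<in> syndromes I J"
    then show "unitary_rep.is_char (local_stab J) s" unfolding syndromes_def using is_char_syndrome by auto
  next
    fix s t assume "s \<in> syndromes I J" "t \<in> syndromes I J" "\<forall>g\<in>local_stab J. s g = t g"
    then show "s = t" unfolding syndromes_def using syndrome_eq_iff by auto
  qed (simp add: split_beta Eop_mult_adj)
  then show ?thesis unfolding sum_insert_None_image_Some[OF finite_syndromes] by (simp add: add.commute)
qed

lemma recovery_kraus_error:
  assumes IJ: "I \<subseteq> J"
    and H1: "\<forall>z\<in>edual C1. restr J z \<in> supported_on I \<longrightarrow> restr J z \<in> C2"
    and H2: "\<forall>z\<in>edual C2. restr J z \<in> supported_on I \<longrightarrow> restr J z \<in> C1"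
    and \<phi>: "\<phi> \<in> Q" and a: "a \<in> supported_on I" and b: "b \<in> supported_on I"
  shows "(\<Sum>k\<in>insert None (Some ` syndromes I J). ketbra (op_app (recovery_kraus I J k) (op_app (Eop a b) \<phi>)))
      = ketbra \<phi>"
proof -
  let ?w = "op_app (Eop a b) \<phi>" and ?s = "syndrome J (a, b)"
  have s: "?s \<in> syndromes I J" using a b unfolding syndromes_def by blast
  obtain a' b' where r: "syndrome_rep I J ?s = (a', b')" by fastforce
  have proj: "op_app (syndrome_proj J s) ?w = (if s = ?s then ?w else (\<lambda>x. 0))" if "s \<in> syndromes I J" for s
    using that syndrome_proj_error[OF \<phi>] unfolding syndromes_def by auto
  have none: "op_app (recovery_kraus I J None) ?w = (\<lambda>x. 0)"
  proof -
    have "(\<Sum>s\<in>syndromes I J. op_app (syndrome_proj J s) ?w x) = ?w x" for x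
    proof -
      have "(\<Sum>s\<in>syndromes I J. op_app (syndrome_proj J s) ?w x)
          = (\<Sum>s\<in>syndromes I J. if s = ?s then ?w x else 0)"
        by (intro sum.cong refl) (simp add: proj)
      then show ?thesis using s finite_syndromes by simp
    qed
    then show ?thesis by (simp add: recovery_kraus_def op_app_diff op_app_sum)
  qed
  have "a - a' \<in> C1" "b - b' \<in> C2"
    using syndrome_eq_imp_diff_in_code[OF IJ H1 H2 a b, of a' b'] syndrome_rep[OF s] r by auto
  then obtain c where c: "norm c = 1" "op_app (op_adj (Eop a' b')) ?w = (\<lambda>x. c * \<phi> x)"
    using op_app_adj_Eop_Eop_stab_code[OF \<phi>] by blast
  have some: "ketbra (op_app (recovery_kraus I J (Some s)) ?w) = (if s = ?s then ketbra \<phi> else 0)"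
    if "s \<in> syndromes I J" for s
    using that r c by (simp add: recovery_kraus_def op_app_mult proj op_app_0 ketbra_cmult_norm_1)
  have "(\<Sum>k\<in>insert None (Some ` syndromes I J). ketbra (op_app (recovery_kraus I J k) ?w))
      = (\<Sum>s\<in>syndromes I J. if s = ?s then ketbra \<phi> else 0)"
    unfolding sum_insert_None_image_Some[OF finite_syndromes] none by (simp add: some)
  also have "\<dots> = ketbra \<phi>" using s finite_syndromes by simp
  finally show ?thesis .
qed

theorem locally_recoverable_iff:
  assumes "I \<subset> J"
  shows "locally_recoverable Q I J \<longleftrightarrow>
           (shorten I (puncture J (edual C1)) = shorten I C2 \<and>
            shorten I (puncture J (edual C2)) = shorten I C1)"
proof -
  have IJ: "I \<subseteq> J" using assms by blast
  have "locally_recoverable Q I J" if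
    "\<forall>z\<in>edual C1. restr J z \<in> supported_on I \<longrightarrow> restr J z \<in> C2"
    "\<forall>z\<in>edual C2. restr J z \<in> supported_on I \<longrightarrow> restr J z \<in> C1"
    using local_on_recovery_kraus[OF IJ] recovery_kraus_complete recovery_kraus_error[OF IJ that]
    by (intro locally_recoverableI[where K = "insert None (Some ` syndromes I J)"])
       (simp_all add: finite_syndromes)
  then show ?thesis
    unfolding shorten_puncture_edual_eq_iff[OF IJ C2_subset] shorten_puncture_edual_eq_iff[OF IJ C1_subset]
    using restr_edual_C1_in_C2[OF _ IJ] restr_edual_C2_in_C1[OF _ IJ] by blast
qed

end

theorem proposition27:
  fixes C1 C2 :: "('n::finite \<Rightarrow> 'a::{finite,field}) set"
    and I J :: "'n set"
    and lam :: "('n, 'a) qop \<Rightarrow> complex"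
  assumes "linear_code C1" and "linear_code C2"
    and "C2 \<subseteq> edual C1"
    and "stab_char (prod_code C1 C2) lam"
    and "I \<noteq> {}" and "I \<subset> J"
  shows "locally_recoverable (stab_code (prod_code C1 C2) lam) I J \<longleftrightarrow>
           (shorten I (puncture J (edual C1)) = shorten I C2 \<and>
            shorten I (puncture J (edual C2)) = shorten I C1)"
proof -
  interpret css_stabilizer C1 C2 lam using assms(1-4) by unfold_locales
  show ?thesis by (rule locally_recoverable_iff[OF assms(6)])
qed

end
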